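(* Let $X_1,X_2,\dots$ be i.i.d. nonnegative random variables such that $\frac1n\sum_{j=1}^nX_j\to c$ almost surely as $n\to\infty$ for some $c\in(0,\infty)$, and let $\Sigma_k=X_1+\dots+X_k$ ($\Sigma_0=0$). Let $r>0$, $\alpha\in\mathbb R\setminus\{0\}$, and for each $n\in\mathbb N$ let $N_{r,\alpha,1/n^{\alpha}}$ have the generalized negative binomial distribution with parameters $r,\alpha,\mu=n^{-\alpha}$ and be independent of $X_1,X_2,\dots$. Then $$\lim_{n\to\infty}\sup_{x\ge0}\Big|\mathsf P\big(\Sigma_{N_{r,\alpha,1/n^{\alpha}}}<nx\big)-\int_0^x g^*(z;r,\alpha,c^{-\alpha})\,dz\Big|=0.$$ If, moreover, $r\in(0,1)$ and $\alpha\in(0,1)$, then the limit GG distribution is mixed exponential: $$G^*_{r,\alpha,c^{-\alpha}}\stackrel{d}{=}\frac{cW_1}{S_{\alpha,1}Z_{r,1}^{1/\alpha}}$$ with independent factors.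
   Context: The generalized gamma density is $g^*(x;r,\alpha,\lambda)=\frac{|\alpha|\lambda^r}{\Gamma(r)}x^{\alpha r-1}e^{-\lambda x^{\alpha}}$, $x\ge0$ ($r>0$, $\lambda>0$, $\alpha\ne0$); $G^*_{r,\alpha,\lambda}$ denotes a random variable with this density. $N_{r,\alpha,\mu}$ has the generalized negative binomial distribution: $\mathsf P(N_{r,\alpha,\mu}=k)=\frac1{k!}\int_0^\infty e^{-z}z^kg^*(z;r,\alpha,\mu)\,dz$, $k\ge0$. $W_1$ is standard exponential. $G_{s,1}$ is gamma with density $\frac1{\Gamma(s)}x^{s-1}e^{-x}$. For $0<\alpha<1$, $S_{\alpha,1}$ has characteristic function $\exp\{-|t|^{\alpha}\exp(-\tfrac12 i\pi\alpha\,\mathrm{sign}\,t)\}$. $Z_{r,1}=(G_{r,1}+G_{1-r,1})/G_{r,1}$ with independent gamma factors. A distribution is mixed exponential if it is the law of $W_1/V$ with $V>0$ independent of $W_1$. *)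

theory Defs
  imports "HOL-Probability.Probability"
begin

definition gg_density :: "real \<Rightarrow> real \<Rightarrow> real \<Rightarrow> real \<Rightarrow> real" where
  "gg_density r \<alpha> l x =
     (if x > 0 then \<bar>\<alpha>\<bar> * l powr r / Gamma r * x powr (\<alpha> * r - 1) * exp (- l * x powr \<alpha>)
      else 0)"

definition gamma_density :: "real \<Rightarrow> real \<Rightarrow> real" where
  "gamma_density s x = (if x > 0 then x powr (s - 1) * exp (- x) / Gamma s else 0)"

definition gnb_pmf :: "real \<Rightarrow> real \<Rightarrow> real \<Rightarrow> nat \<Rightarrow> real" where
  "gnb_pmf r \<alpha> \<mu> k = (1 / fact k) * (\<integral>z. exp (- z) * z ^ k * gg_density r \<alpha> \<mu> z \<partial>lborel)"

end

theory Submission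
  imports Defs "HOL-Complex_Analysis.Complex_Analysis" "HOL-Real_Asymp.Real_Asymp"
begin

text \<open>
  Conditionally on a mixing variable \<open>Y\<close> with density \<open>gg_density r \<alpha> 1\<close>, \<open>N n\<close> is Poisson with
  mean \<open>n * Y\<close>, whence \<open>N n / n\<close> converges in law to \<open>Y\<close> by Levy's continuity theorem. As the
  partial sums increase, comparing \<open>N n\<close> with the deterministic number \<open>\<lfloor>n * y\<rfloor>\<close> for \<open>y\<close> close to
  \<open>x / c\<close> squeezes the distribution function of the random sum, by the law of large numbers, to
  that of \<open>c * Y\<close>. Polya's argument makes the convergence uniform.

  For the mixture, the tail of \<open>W / V\<close> with \<open>W\<close> standard exponential and independent of \<open>V > 0\<close> is
  the Laplace transform of \<open>V\<close>. That of \<open>S\<close> is found by extending its characteristic function to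
  a bounded holomorphic function on the upper half plane and applying Poisson's formula; a kernel
  with poles only in the lower half plane shows \<open>S \<ge> 0\<close>. Integrating out \<open>W\<close>, \<open>S\<close> and \<open>G2\<close> in turn
  leaves a gamma tail, which is the tail of the generalized gamma law.
\<close>

section \<open>Gamma and generalized gamma distributions\<close>

abbreviation gamma_distribution :: "real \<Rightarrow> real measure" where
  "gamma_distribution s \<equiv> density lborel (\<lambda>x. ennreal (gamma_density s x))"

abbreviation gg_distribution :: "real \<Rightarrow> real \<Rightarrow> real \<Rightarrow> real measure" where
  "gg_distribution r \<alpha> l \<equiv> density lborel (\<lambda>x. ennreal (gg_density r \<alpha> l x))"

lemma gamma_density_nonneg [simp]: "s > 0 \<Longrightarrow> 0 \<le> gamma_density s x"
  by (simp add: gamma_density_def)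

lemma borel_measurable_gamma_density [measurable]: "gamma_density s \<in> borel_measurable borel"
  unfolding gamma_density_def[abs_def] by measurable

lemma gg_density_nonneg [simp]: "r > 0 \<Longrightarrow> 0 \<le> gg_density r \<alpha> l x"
  by (simp add: gg_density_def)

lemma borel_measurable_gg_density [measurable]: "gg_density r \<alpha> l \<in> borel_measurable borel"
  unfolding gg_density_def[abs_def] by measurable

lemma AE_gamma_distribution_pos: "AE x in gamma_distribution s. 0 < x"
  by (subst AE_density) (auto simp: gamma_density_def)

lemma AE_gg_distribution_pos: "AE x in gg_distribution r \<alpha> l. 0 < x"
  by (subst AE_density) (auto simp: gg_density_def)

lemma nn_integral_gamma_density:
  assumes "s > 0"
  shows "(\<integral>\<^sup>+x. ennreal (gamma_density s x) \<partial>lborel) = 1"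
proof -
  have "(\<integral>\<^sup>+x. ennreal (gamma_density s x) \<partial>lborel) =
    (\<integral>\<^sup>+x. ennreal (indicator {0..} x * x powr (s - 1) / exp x) * ennreal (1 / Gamma s) \<partial>lborel)"
    using assms by (intro nn_integral_cong)
     (auto simp: gamma_density_def indicator_def exp_minus divide_simps simp flip: ennreal_mult')
  also have "\<dots> = ennreal (Gamma s) * ennreal (1 / Gamma s)"
    by (subst nn_integral_multc) (auto simp: Gamma_conv_nn_integral_real[OF assms])
  also have "\<dots> = 1"
    using Gamma_real_pos[OF assms] by (simp flip: ennreal_mult')
  finally show ?thesis .
qed

lemma integrable_gamma_density: "0 < s \<Longrightarrow> integrable lborel (gamma_density s)"
  by (intro integrableI_nonneg) (auto simp: nn_integral_gamma_density)

lemma nn_integral_change_of_variables_inj: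
  fixes f g g' :: "real \<Rightarrow> real"
  assumes S: "S \<in> sets lebesgue"
    and der: "\<And>x. x \<in> S \<Longrightarrow> (g has_field_derivative g' x) (at x within S)"
    and inj: "inj_on g S"
    and int: "f absolutely_integrable_on g ` S"
    and nonneg: "\<And>y. y \<in> g ` S \<Longrightarrow> 0 \<le> f y"
  shows "(\<integral>\<^sup>+x\<in>S. ennreal (\<bar>g' x\<bar> * f (g x)) \<partial>lborel) = (\<integral>\<^sup>+y\<in>g ` S. ennreal (f y) \<partial>lborel)"
proof -
  define I where "I = integral (g ` S) f"
  have lhs_int: "(\<lambda>x. \<bar>g' x\<bar> * f (g x)) absolutely_integrable_on S"
    and lhs_eq: "integral S (\<lambda>x. \<bar>g' x\<bar> * f (g x)) = I"
    using has_absolute_integral_change_of_variables_1'[OF S der inj] int by (auto simp: I_def)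
  have "(f has_integral I) (g ` S)"
    unfolding I_def using int set_lebesgue_integral_eq_integral(1) by blast
  moreover have "((\<lambda>x. \<bar>g' x\<bar> * f (g x)) has_integral I) S"
    using lhs_int lhs_eq set_lebesgue_integral_eq_integral(1) by blast
  ultimately show ?thesis
    using nonneg by (simp add: nn_integral_has_integral_lebesgue')
qed

lemma bij_betw_scaled_powr:
  fixes l \<alpha> :: real
  assumes l: "l > 0" and \<alpha>: "\<alpha> \<noteq> 0"
  shows "bij_betw (\<lambda>x. l * x powr \<alpha>) {0<..} {0<..}"
  by (rule bij_betw_byWitness[where f' = "\<lambda>u. (u / l) powr (1 / \<alpha>)"])
     (use assms in \<open>auto simp: powr_powr\<close>)

lemma nn_integral_substitution_scaled_powr:
  fixes f :: "real \<Rightarrow> real"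
  assumes l: "l > 0" and \<alpha>: "\<alpha> \<noteq> 0"
    and int: "integrable lborel f" and nonneg: "\<And>u. 0 < u \<Longrightarrow> 0 \<le> f u"
  shows "(\<integral>\<^sup>+x\<in>{0<..}. ennreal (\<bar>l * (\<alpha> * x powr (\<alpha> - 1))\<bar> * f (l * x powr \<alpha>)) \<partial>lborel) =
    (\<integral>\<^sup>+u\<in>{0<..}. ennreal (f u) \<partial>lborel)"
proof -
  let ?g = "\<lambda>x. l * x powr \<alpha>"
  have img: "?g ` {0<..} = {0<..}" and inj: "inj_on ?g {0<..}"
    using bij_betw_scaled_powr[OF l \<alpha>] by (auto simp: bij_betw_def)
  have der: "(?g has_field_derivative l * (\<alpha> * x powr (\<alpha> - 1))) (at x within {0<..})"
    if "x \<in> {0<..}" for x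
    using that
    by (auto intro!: has_field_derivative_at_within[OF DERIV_cmult[OF has_real_derivative_powr]])
  have "f absolutely_integrable_on ?g ` {0<..}"
  proof (rule set_integrable_subset[of lebesgue UNIV])
    show "set_integrable lebesgue UNIV f"
      using int by (simp add: set_integrable_def integrable_completion)
  qed (simp_all add: img)
  then show ?thesis
    using nn_integral_change_of_variables_inj[OF _ der inj] nonneg by (simp add: img)
qed

lemma gg_density_conv_gamma_density:
  assumes l: "l > 0" and x: "x > 0"
  shows "gg_density r \<alpha> l x = \<bar>l * (\<alpha> * x powr (\<alpha> - 1))\<bar> * gamma_density r (l * x powr \<alpha>)"
proof -
  have "\<bar>l * (\<alpha> * x powr (\<alpha> - 1))\<bar> * gamma_density r (l * x powr \<alpha>) =
     \<bar>\<alpha>\<bar> / Gamma r * (l powr 1 * l powr (r - 1)) *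
       (x powr (\<alpha> - 1) * (x powr \<alpha>) powr (r - 1)) * exp (- l * x powr \<alpha>)"
    using l x by (simp add: gamma_density_def abs_mult powr_mult)
  also have "\<dots> = gg_density r \<alpha> l x"
    unfolding powr_powr powr_add[symmetric] using x by (simp add: gg_density_def algebra_simps)
  finally show ?thesis by simp
qed

lemma distr_gg_distribution_powr:
  assumes r: "r > 0" and \<alpha>: "\<alpha> \<noteq> 0" and l: "l > 0"
  shows "distr (gg_distribution r \<alpha> l) borel (\<lambda>x. l * x powr \<alpha>) = gamma_distribution r"
proof (rule measure_eqI)
  fix T assume "T \<in> sets (distr (gg_distribution r \<alpha> l) borel (\<lambda>x. l * x powr \<alpha>))"
  then have T [measurable]: "T \<in> sets borel" by simp
  let ?g = "\<lambda>x. l * x powr \<alpha>" and ?f = "\<lambda>u. gamma_density r u * indicator T u"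
  have f_int: "integrable lborel ?f"
    using integrable_gamma_density[OF r] by (intro integrable_real_mult_indicator) simp_all
  have "emeasure (distr (gg_distribution r \<alpha> l) borel ?g) T =
      (\<integral>\<^sup>+x. ennreal (gg_density r \<alpha> l x) * indicator T (?g x) \<partial>lborel)"
    by (simp add: emeasure_distr emeasure_density measurable_sets_borel[OF _ T] indicator_def)
  also have "\<dots> = (\<integral>\<^sup>+x\<in>{0<..}. ennreal (\<bar>l * (\<alpha> * x powr (\<alpha> - 1))\<bar> * ?f (?g x)) \<partial>lborel)"
  proof (rule nn_integral_cong)
    show "ennreal (gg_density r \<alpha> l x) * indicator T (?g x) =
        ennreal (\<bar>l * (\<alpha> * x powr (\<alpha> - 1))\<bar> * ?f (?g x)) * indicator {0<..} x" for x
    proof (cases "0 < x")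
      case True
      then show ?thesis using gg_density_conv_gamma_density[OF l True] by (simp add: indicator_def)
    qed (simp add: gg_density_def)
  qed
  also have "\<dots> = (\<integral>\<^sup>+u\<in>{0<..}. ennreal (?f u) \<partial>lborel)"
    using r by (intro nn_integral_substitution_scaled_powr l \<alpha> f_int) simp
  also have "\<dots> = (\<integral>\<^sup>+u. ennreal (gamma_density r u) * indicator T u \<partial>lborel)"
    by (intro nn_integral_cong) (auto simp: gamma_density_def indicator_def)
  also have "\<dots> = emeasure (gamma_distribution r) T"
    by (simp add: emeasure_density)
  finally show "emeasure (distr (gg_distribution r \<alpha> l) borel ?g) T =
      emeasure (gamma_distribution r) T" .
qed simp

lemma nn_integral_gg_density:
  assumes "r > 0" "\<alpha> \<noteq> 0" "l > 0"
  shows "(\<integral>\<^sup>+x. ennreal (gg_density r \<alpha> l x) \<partial>lborel) = 1"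
proof -
  have "emeasure (distr (gg_distribution r \<alpha> l) borel (\<lambda>x. l * x powr \<alpha>)) UNIV = 1"
    unfolding distr_gg_distribution_powr[OF assms]
    using assms by (simp add: emeasure_density nn_integral_gamma_density)
  then show ?thesis by (simp add: emeasure_distr emeasure_density)
qed

lemma real_distribution_gg:
  assumes "r > 0" "\<alpha> \<noteq> 0" "l > 0"
  shows "real_distribution (gg_distribution r \<alpha> l)"
proof -
  have "prob_space (gg_distribution r \<alpha> l)"
    using nn_integral_gg_density[OF assms] by (intro prob_spaceI) (simp add: emeasure_density)
  then show ?thesis
    by (simp add: real_distribution_def real_distribution_axioms_def)
qed

lemma gg_density_scale:
  assumes c: "c > 0" and l: "l > 0"
  shows "gg_density r \<alpha> (l * c powr - \<alpha>) x = gg_density r \<alpha> l (x / c) / c"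
proof (cases "x > 0")
  case True
  have rate: "l * c powr - \<alpha> * x powr \<alpha> = l * (x / c) powr \<alpha>"
    using c True by (simp add: powr_divide powr_minus_divide)
  have "(l * c powr - \<alpha>) powr r * x powr (\<alpha> * r - 1) =
      l powr r * (x powr (\<alpha> * r - 1) / c powr (\<alpha> * r))"
    using c l by (simp add: powr_mult powr_divide powr_powr powr_minus_divide)
  also have "c powr (\<alpha> * r) = c powr (\<alpha> * r - 1) * c"
    using c by (simp add: powr_diff)
  finally have front: "(l * c powr - \<alpha>) powr r * x powr (\<alpha> * r - 1) =
      l powr r * (x / c) powr (\<alpha> * r - 1) / c"
    using c True by (simp add: powr_divide)
  have "gg_density r \<alpha> (l * c powr - \<alpha>) x =
      \<bar>\<alpha>\<bar> / Gamma r * ((l * c powr - \<alpha>) powr r * x powr (\<alpha> * r - 1)) *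
        exp (- (l * c powr - \<alpha> * x powr \<alpha>))"
    using True by (simp add: gg_density_def)
  also have "\<dots> = gg_density r \<alpha> l (x / c) / c"
    unfolding rate front using True c by (simp add: gg_density_def)
  finally show ?thesis .
next
  case False
  then show ?thesis using c by (simp add: gg_density_def zero_less_divide_iff)
qed

lemma distr_gg_distribution_scale:
  assumes r: "r > 0" and \<alpha>: "\<alpha> \<noteq> 0" and l: "l > 0" and c: "c > 0"
  shows "distr (gg_distribution r \<alpha> l) borel ((*) c) = gg_distribution r \<alpha> (l * c powr - \<alpha>)"
proof -
  interpret real_distribution "gg_distribution r \<alpha> l"
    using assms by (intro real_distribution_gg)
  have "distributed (gg_distribution r \<alpha> l) lborel (\<lambda>x. x) (\<lambda>x. ennreal (gg_density r \<alpha> l x))"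
    by (simp add: distributed_def distr_id2)
  from distributed_affine[OF this, of c 0]
  have "distr (gg_distribution r \<alpha> l) lborel ((*) c) =
      density lborel (\<lambda>x. ennreal (gg_density r \<alpha> l (x / c)) / ennreal c)"
    using c by (simp add: distributed_def)
  also have "\<dots> = gg_distribution r \<alpha> (l * c powr - \<alpha>)"
    using r c by (simp add: gg_density_scale[OF c l] divide_ennreal)
  finally show ?thesis by (simp cong: distr_cong)
qed

lemma emeasure_gg_distribution_greaterThan:
  assumes r: "r > 0" and \<alpha>: "\<alpha> > 0" and l: "l > 0" and x: "x \<ge> 0"
  shows "emeasure (gg_distribution r \<alpha> l) {x<..} =
    emeasure (gamma_distribution r) {l * x powr \<alpha><..}"
proof -
  have "emeasure (gamma_distribution r) {l * x powr \<alpha><..} =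
      emeasure (gg_distribution r \<alpha> l) ((\<lambda>z. l * z powr \<alpha>) -` {l * x powr \<alpha><..})"
    using r \<alpha> l
    by (subst distr_gg_distribution_powr[of r \<alpha> l, symmetric]) (simp_all add: emeasure_distr)
  also have "\<dots> = emeasure (gg_distribution r \<alpha> l) {x<..}"
  proof (rule emeasure_eq_AE)
    have powr_less: "x powr \<alpha> < z powr \<alpha> \<longleftrightarrow> x < z" if "0 < z" for z
      using that x \<alpha> by (metis less_eq_real_def not_less powr_less_mono2 powr_mono2)
    show "AE z in gg_distribution r \<alpha> l.
        z \<in> (\<lambda>z. l * z powr \<alpha>) -` {l * x powr \<alpha><..} \<longleftrightarrow> z \<in> {x<..}"
      using AE_gg_distribution_pos[of r \<alpha> l] by eventually_elim (use l powr_less in simp)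
  qed (use measurable_sets_borel[of "\<lambda>z. l * z powr \<alpha>" borel "{l * x powr \<alpha><..}"] in auto)
  finally show ?thesis ..
qed

lemma cdf_density_eq_interval_integral:
  assumes f: "integrable lborel f" and nonneg: "\<And>z. 0 \<le> f z"
    and zero: "\<And>z. z < 0 \<Longrightarrow> f z = 0" and x: "0 \<le> x"
  shows "cdf (density lborel (\<lambda>z. ennreal (f z))) x = (LBINT z=0..x. f z)"
proof -
  have [measurable]: "f \<in> borel_measurable borel" using f by simp
  have "cdf (density lborel (\<lambda>z. ennreal (f z))) x =
      (\<integral>z. indicator {..x} z \<partial>density lborel (\<lambda>z. ennreal (f z)))"
    by (simp add: cdf_def)
  also have "\<dots> = (\<integral>z. f z * indicator {..x} z \<partial>lborel)"
    using nonneg by (subst integral_real_density) auto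
  also have "\<dots> = (\<integral>z. indicator (einterval 0 (ereal x)) z * f z \<partial>lborel)"
  proof (rule integral_cong_AE)
    show "AE z in lborel. f z * indicator {..x} z = indicator (einterval 0 (ereal x)) z * f z"
      using AE_lborel_singleton[of x] AE_lborel_singleton[of 0]
      by eventually_elim (use zero in \<open>auto simp: indicator_def einterval_def\<close>)
  qed auto
  also have "\<dots> = (LBINT z=0..x. f z)"
    using x by (simp add: interval_lebesgue_integral_def set_lebesgue_integral_def zero_ereal_def)
  finally show ?thesis .
qed

lemma isCont_cdf_density_lborel:
  assumes "real_distribution (density lborel f)" and [measurable]: "f \<in> borel_measurable borel"
  shows "isCont (cdf (density lborel f)) x"
proof -
  interpret real_distribution "density lborel f" by fact
  have "AE z in lborel. z \<noteq> x" by (rule AE_lborel_singleton)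
  then have "emeasure (density lborel f) {x} = 0"
    by (simp add: emeasure_density)
  then show ?thesis by (simp add: isCont_cdf measure_def)
qed

section \<open>Mixed Poisson distributions\<close>

definition mixed_Poisson_pmf :: "real measure \<Rightarrow> nat \<Rightarrow> real" where
  "mixed_Poisson_pmf D k = (\<integral>z. exp (- z) * z ^ k / fact k \<partial>D)"

lemma gnb_pmf_eq_mixed_Poisson_pmf:
  assumes "r > 0"
  shows "gnb_pmf r \<alpha> \<mu> = mixed_Poisson_pmf (gg_distribution r \<alpha> \<mu>)"
proof
  fix k
  have "gnb_pmf r \<alpha> \<mu> k = (\<integral>z. gg_density r \<alpha> \<mu> z * (exp (- z) * z ^ k / fact k) \<partial>lborel)"
    unfolding gnb_pmf_def integral_mult_right_zero[symmetric]
    by (intro Bochner_Integration.integral_cong) simp_all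
  also have "\<dots> = mixed_Poisson_pmf (gg_distribution r \<alpha> \<mu>) k"
    unfolding mixed_Poisson_pmf_def using assms by (subst integral_real_density) auto
  finally show "gnb_pmf r \<alpha> \<mu> k = mixed_Poisson_pmf (gg_distribution r \<alpha> \<mu>) k" .
qed

lemma (in prob_space) summable_integral_partition_of_unity:
  fixes u :: "nat \<Rightarrow> 'a \<Rightarrow> real"
  assumes u [measurable]: "\<And>k. u k \<in> borel_measurable M"
    and partition: "AE x in M. (\<forall>k. 0 \<le> u k x) \<and> (\<lambda>k. u k x) sums 1"
  shows "integrable M (u k)" and "summable (\<lambda>k. \<integral>x. u k x \<partial>M)"
proof -
  have sum_le: "(\<Sum>k<n. u k x) \<le> 1" if "(\<forall>k. 0 \<le> u k x) \<and> (\<lambda>k. u k x) sums 1" for n x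
    using that sum_le_suminf[of "\<lambda>k. u k x" "{..<n}"] by (auto simp: sums_iff)
  have u_le: "u k x \<le> 1" if "(\<forall>k. 0 \<le> u k x) \<and> (\<lambda>k. u k x) sums 1" for k x
    using member_le_sum[of k "{..<Suc k}" "\<lambda>k. u k x"] sum_le[OF that, of "Suc k"] that by fastforce
  show u_int: "integrable M (u k)" for k
  proof (rule integrable_const_bound[of _ 1])
    show "AE x in M. norm (u k x) \<le> 1"
      using partition by eventually_elim (auto simp: u_le)
  qed simp
  show "summable (\<lambda>k. \<integral>x. u k x \<partial>M)"
  proof (rule summableI_nonneg_bounded)
    show "0 \<le> (\<integral>x. u k x \<partial>M)" for k
      using partition by (intro integral_nonneg_AE) (auto elim!: eventually_mono)
    have "(\<integral>x. (\<Sum>k<n. u k x) \<partial>M) \<le> (\<integral>x. 1 \<partial>M)" for n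
      by (intro integral_mono_AE Bochner_Integration.integrable_sum u_int integrable_const
          eventually_mono[OF partition sum_le])
    then show "(\<Sum>k<n. \<integral>x. u k x \<partial>M) \<le> 1" for n by (simp add: prob_space u_int)
  qed
qed

lemma (in prob_space) sums_integral_partition_of_unity:
  fixes u :: "nat \<Rightarrow> 'a \<Rightarrow> real"
    and f :: "nat \<Rightarrow> 'b::{real_normed_field, banach, second_countable_topology}"
  assumes u: "\<And>k. u k \<in> borel_measurable M"
    and partition: "AE x in M. (\<forall>k. 0 \<le> u k x) \<and> (\<lambda>k. u k x) sums 1"
    and f: "\<And>k. norm (f k) \<le> 1"
  shows "(\<lambda>k. f k * of_real (\<integral>x. u k x \<partial>M)) sums (\<integral>x. (\<Sum>k. f k * of_real (u k x)) \<partial>M)"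
proof -
  note u_int = summable_integral_partition_of_unity(1)[OF u partition]
    and summable_u = summable_integral_partition_of_unity(2)[OF u partition]
  have norm_le: "norm (f k * of_real a) \<le> a" if "0 \<le> a" for k a
    using mult_right_mono[OF f[of k] that] that by (simp add: norm_mult)
  have "(\<lambda>k. \<integral>x. f k * of_real (u k x) \<partial>M) sums (\<integral>x. (\<Sum>k. f k * of_real (u k x)) \<partial>M)"
  proof (rule sums_integral)
    show "integrable M (\<lambda>x. f k * of_real (u k x))" for k
      using u_int by auto
    show "AE x in M. summable (\<lambda>k. norm (f k * of_real (u k x)))"
      using partition
      by eventually_elim
        (auto intro!: summable_comparison_test'[OF sums_summable, of _ 1 0] simp: norm_le)
    have "(\<integral>x. norm (f k * of_real (u k x)) \<partial>M) \<le> (\<integral>x. u k x \<partial>M)" for k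
      using partition by (intro integral_mono_AE) (auto elim!: eventually_mono simp: u_int norm_le)
    then show "summable (\<lambda>k. \<integral>x. norm (f k * of_real (u k x)) \<partial>M)"
      by (intro summable_comparison_test'[OF summable_u, of 0]) simp
  qed
  then show ?thesis
    by (simp add: integral_bounded_linear[OF bounded_linear_of_real u_int])
qed

lemma Poisson_power_sums:
  fixes z :: real and w :: complex
  shows "(\<lambda>k. w ^ k * of_real (exp (- z) * z ^ k / fact k)) sums exp (of_real z * (w - 1))"
proof -
  have "(\<lambda>k. of_real (exp (- z)) * ((of_real z * w) ^ k /\<^sub>R fact k)) sums
      (of_real (exp (- z)) * exp (of_real z * w))"
    by (intro sums_mult exp_converges)
  moreover have "of_real (exp (- z)) * exp (of_real z * w) = exp (of_real z * (w - 1))"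
    by (simp add: exp_of_real[symmetric] right_diff_distrib exp_diff exp_minus field_simps)
  ultimately show ?thesis
    by (simp add: power_mult_distrib scaleR_conv_of_real field_simps)
qed

lemma mixed_Poisson_pmf_power_sums:
  fixes w :: complex
  assumes "real_distribution D" and nonneg: "AE z in D. 0 \<le> z" and w: "norm w \<le> 1"
  shows "(\<lambda>k. w ^ k * of_real (mixed_Poisson_pmf D k)) sums (\<integral>z. exp (of_real z * (w - 1)) \<partial>D)"
proof -
  interpret real_distribution D by fact
  have "(\<lambda>k. w ^ k * of_real (\<integral>z. exp (- z) * z ^ k / fact k \<partial>D)) sums
      (\<integral>z. (\<Sum>k. w ^ k * of_real (exp (- z) * z ^ k / fact k)) \<partial>D)"
  proof (rule sums_integral_partition_of_unity)
    have Poisson_sums: "(\<lambda>k. exp (- z) * z ^ k / fact k :: real) sums 1" for z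
      using Poisson_power_sums[of 1 z] by (simp add: sums_of_real_iff[symmetric, where 'a=complex])
    show "AE z in D. (\<forall>k. 0 \<le> exp (- z) * z ^ k / fact k) \<and> (\<lambda>k. exp (- z) * z ^ k / fact k) sums 1"
      using nonneg by eventually_elim (simp add: Poisson_sums)
    show "norm (w ^ k) \<le> 1" for k using w by (simp add: norm_power power_le_one)
  qed simp
  moreover have "(\<Sum>k. w ^ k * of_real (exp (- z) * z ^ k / fact k)) = exp (of_real z * (w - 1))"
    for z
    using sums_unique[OF Poisson_power_sums] by (rule sym)
  ultimately show ?thesis by (simp only: mixed_Poisson_pmf_def)
qed

lemma (in prob_space) sums_expectation_nat_valued:
  fixes f :: "nat \<Rightarrow> 'b::{real_normed_field, banach, second_countable_topology}"
  assumes N [measurable]: "N \<in> measurable M (count_space UNIV)" and f: "\<And>k. norm (f k) \<le> 1"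
  shows "(\<lambda>k. f k * of_real (prob {\<omega> \<in> space M. N \<omega> = k})) sums expectation (\<lambda>\<omega>. f (N \<omega>))"
proof -
  let ?u = "\<lambda>k. indicator {\<omega> \<in> space M. N \<omega> = k} :: 'a \<Rightarrow> real"
  have "(\<lambda>k. f k * of_real (expectation (?u k))) sums expectation (\<lambda>\<omega>. \<Sum>k. f k * of_real (?u k \<omega>))"
  proof (rule sums_integral_partition_of_unity)
    have "(\<lambda>k. ?u k \<omega>) sums 1" if "\<omega> \<in> space M" for \<omega>
      using that sums_single[of "N \<omega>" "\<lambda>_. 1::real"]
      by (simp add: indicator_def of_bool_def eq_commute)
    then show "AE \<omega> in M. (\<forall>k. 0 \<le> ?u k \<omega>) \<and> (\<lambda>k. ?u k \<omega>) sums 1"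
      by (intro AE_I2) auto
  qed (auto simp: f)
  also have "expectation (\<lambda>\<omega>. \<Sum>k. f k * of_real (?u k \<omega>)) = expectation (\<lambda>\<omega>. f (N \<omega>))"
  proof (rule Bochner_Integration.integral_cong)
    fix \<omega> assume "\<omega> \<in> space M"
    then show "(\<Sum>k. f k * of_real (?u k \<omega>)) = f (N \<omega>)"
      using suminf_finite[of "{N \<omega>}" "\<lambda>k. f k * of_real (?u k \<omega>)"] by simp
  qed simp
  finally show ?thesis by simp
qed

lemma (in prob_space) expectation_power_mixed_Poisson:
  fixes w :: complex
  assumes N: "N \<in> measurable M (count_space UNIV)"
    and D: "real_distribution D" and nonneg: "AE z in D. 0 \<le> z"
    and pmf: "\<And>k. prob {\<omega> \<in> space M. N \<omega> = k} = mixed_Poisson_pmf D k"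
    and w: "norm w \<le> 1"
  shows "expectation (\<lambda>\<omega>. w ^ N \<omega>) = (\<integral>z. exp (of_real z * (w - 1)) \<partial>D)"
proof -
  have "norm (w ^ k) \<le> 1" for k using w by (simp add: norm_power power_le_one)
  from sums_expectation_nat_valued[OF N this] mixed_Poisson_pmf_power_sums[OF D nonneg w]
  show ?thesis unfolding pmf by (rule sums_unique2)
qed

lemma tendsto_scaled_iexp_minus_1: "(\<lambda>n. of_nat n * (iexp (t / real n) - 1)) \<longlonglongrightarrow> \<i> * of_real t"
proof -
  have "(\<lambda>n. real n * (cos (t / real n) - 1)) \<longlonglongrightarrow> 0" "(\<lambda>n. real n * sin (t / real n)) \<longlonglongrightarrow> t"
    by real_asymp+
  then show ?thesis
    by (simp add: tendsto_complex_iff Re_exp Im_exp)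
qed

text \<open>Given the value \<open>y\<close> of the mixing variable, \<open>N n / n\<close> has the characteristic function
  \<open>exp (n * y * (iexp (t / n) - 1))\<close>, which tends to \<open>iexp (t * y)\<close>.\<close>
lemma (in prob_space) weak_conv_scaled_mixed_Poisson:
  fixes N :: "nat \<Rightarrow> 'a \<Rightarrow> nat"
  assumes N [measurable]: "\<And>n. N n \<in> measurable M (count_space UNIV)"
    and D: "real_distribution D" and nonneg: "AE y in D. 0 \<le> y"
    and pmf: "\<And>n k. n \<ge> 1 \<Longrightarrow>
      prob {\<omega> \<in> space M. N n \<omega> = k} = mixed_Poisson_pmf (distr D borel ((*) (real n))) k"
  shows "weak_conv_m (\<lambda>n. distr M borel (\<lambda>\<omega>. real (N n \<omega>) / real n)) D"
proof (rule levy_continuity[OF _ D])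
  interpret D: real_distribution D by fact
  show "real_distribution (distr M borel (\<lambda>\<omega>. real (N n \<omega>) / real n))" for n
    by (rule real_distribution_distr) simp
  fix t
  let ?\<phi> = "\<lambda>n y. exp (of_real (real n * y) * (iexp (t / real n) - 1))"
  have char: "char (distr M borel (\<lambda>\<omega>. real (N n \<omega>) / real n)) t = (\<integral>y. ?\<phi> n y \<partial>D)"
    if n: "n \<ge> 1" for n
  proof -
    have "iexp (t * (real k / real n)) = iexp (t / real n) ^ k" for k
      by (simp add: exp_of_nat_mult[symmetric] mult_ac)
    then have "char (distr M borel (\<lambda>\<omega>. real (N n \<omega>) / real n)) t =
        expectation (\<lambda>\<omega>. iexp (t / real n) ^ N n \<omega>)"
      unfolding char_def by (subst integral_distr) simp_all
    also have "\<dots> = (\<integral>z. exp (of_real z * (iexp (t / real n) - 1)) \<partial>distr D borel ((*) (real n)))"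
    proof (rule expectation_power_mixed_Poisson[OF N])
      show "AE z in distr D borel ((*) (real n)). 0 \<le> z"
        using nonneg by (subst AE_distr_iff) auto
    qed (auto simp: pmf[OF n])
    also have "\<dots> = (\<integral>y. ?\<phi> n y \<partial>D)" by (subst integral_distr) auto
    finally show ?thesis .
  qed
  have "(\<lambda>n. \<integral>y. ?\<phi> n y \<partial>D) \<longlonglongrightarrow> (\<integral>y. iexp (t * y) \<partial>D)"
  proof (rule integral_dominated_convergence[where w = "\<lambda>_. 1"])
    have "(\<lambda>n. exp (of_real y * (of_nat n * (iexp (t / real n) - 1)))) \<longlonglongrightarrow>
        exp (of_real y * (\<i> * of_real t))" for y
      by (intro tendsto_intros tendsto_scaled_iexp_minus_1)
    then show "AE y in D. (\<lambda>n. ?\<phi> n y) \<longlonglongrightarrow> iexp (t * y)"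
      by (intro AE_I2) (simp add: mult_ac)
    show "AE y in D. norm (?\<phi> n y) \<le> 1" for n
      using nonneg by eventually_elim (auto simp: Re_exp mult_le_0_iff zero_le_mult_iff)
  qed auto
  then show "(\<lambda>n. char (distr M borel (\<lambda>\<omega>. real (N n \<omega>) / real n)) t) \<longlonglongrightarrow> char D t"
    unfolding char_def[of D]
    by (rule Lim_transform_eventually) (use char in \<open>auto intro!: eventually_sequentiallyI[of 1]\<close>)
qed

section \<open>Convergence of the random sums\<close>

lemma (in prob_space) prob_tendsto_1:
  assumes A [measurable]: "\<And>n::nat. A n \<in> events"
    and ev: "AE \<omega> in M. \<forall>\<^sub>F n in sequentially. \<omega> \<in> A n"
  shows "(\<lambda>n. prob (A n)) \<longlonglongrightarrow> 1"
proof -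
  have "(\<lambda>n. \<integral>\<omega>. indicator (A n) \<omega> \<partial>M) \<longlonglongrightarrow> (\<integral>\<omega>. (1::real) \<partial>M)"
  proof (rule integral_dominated_convergence[where w="\<lambda>_. 1"])
    show "AE \<omega> in M. (\<lambda>n. indicator (A n) \<omega> :: real) \<longlonglongrightarrow> 1"
      using ev by eventually_elim (auto intro!: tendsto_eventually elim!: eventually_mono)
  qed auto
  then show ?thesis by (simp add: prob_space)
qed

lemma (in prob_space) prob_tendsto_0:
  assumes A [measurable]: "\<And>n::nat. A n \<in> events"
    and ev: "AE \<omega> in M. \<forall>\<^sub>F n in sequentially. \<omega> \<notin> A n"
  shows "(\<lambda>n. prob (A n)) \<longlonglongrightarrow> 0"
proof -
  have "AE \<omega> in M. \<forall>\<^sub>F n in sequentially. \<omega> \<in> space M - A n"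
    using ev AE_space by eventually_elim simp
  then have "(\<lambda>n. 1 - prob (space M - A n)) \<longlonglongrightarrow> 1 - 1"
    by (intro tendsto_diff tendsto_const prob_tendsto_1) auto
  then show ?thesis by (simp add: prob_compl)
qed

lemma tendsto_floor_scaled_average:
  fixes s :: "nat \<Rightarrow> real"
  assumes s: "(\<lambda>n. s n / real n) \<longlonglongrightarrow> c" and s0: "s 0 = 0" and y: "0 \<le> y"
  shows "(\<lambda>n. s (nat \<lfloor>real n * y\<rfloor>) / real n) \<longlonglongrightarrow> c * y"
proof (cases "y = 0")
  case False
  let ?m = "\<lambda>n. nat \<lfloor>real n * y\<rfloor>"
  have "filterlim ?m at_top sequentially" and "(\<lambda>n. real (?m n) / real n) \<longlonglongrightarrow> y"
    using y False by real_asymp+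
  then have "(\<lambda>n. s (?m n) / real (?m n) * (real (?m n) / real n)) \<longlonglongrightarrow> c * y"
    by (intro tendsto_mult filterlim_compose[OF s])
  moreover have "s k / real k * (real k / real n) = s k / real n" for k n
    using s0 by (cases "k = 0") auto
  ultimately show ?thesis by (simp only:)
qed (simp add: s0)

lemma (in prob_space) prob_partial_sum_tendsto_0:
  fixes X :: "nat \<Rightarrow> 'a \<Rightarrow> real"
  assumes X [measurable]: "\<And>i. X i \<in> borel_measurable M"
    and slln: "AE \<omega> in M. (\<lambda>n. (\<Sum>j<n. X j \<omega>) / real n) \<longlonglongrightarrow> c"
    and y: "0 \<le> y"
  shows "c * y < x \<Longrightarrow> (\<lambda>n. prob {\<omega> \<in> space M. real n * x \<le> (\<Sum>j<nat \<lfloor>real n * y\<rfloor>. X j \<omega>)}) \<longlonglongrightarrow> 0"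
    and "x < c * y \<Longrightarrow> (\<lambda>n. prob {\<omega> \<in> space M. (\<Sum>j<nat \<lfloor>real n * y\<rfloor>. X j \<omega>) < real n * x}) \<longlonglongrightarrow> 0"
proof -
  let ?S = "\<lambda>n \<omega>. \<Sum>j<nat \<lfloor>real n * y\<rfloor>. X j \<omega>"
  have lim: "AE \<omega> in M. (\<lambda>n. ?S n \<omega> / real n) \<longlonglongrightarrow> c * y"
    using slln by eventually_elim (rule tendsto_floor_scaled_average[OF _ _ y], auto)
  have below: "\<forall>\<^sub>F n in sequentially. ?S n \<omega> < real n * x"
    if "(\<lambda>n. ?S n \<omega> / real n) \<longlonglongrightarrow> c * y" "c * y < x" for \<omega>
    using order_tendstoD(2)[OF that] eventually_gt_at_top[of 0]
    by eventually_elim (simp add: field_simps)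
  have above: "\<forall>\<^sub>F n in sequentially. real n * x \<le> ?S n \<omega>"
    if "(\<lambda>n. ?S n \<omega> / real n) \<longlonglongrightarrow> c * y" "x < c * y" for \<omega>
    using order_tendstoD(1)[OF that] eventually_gt_at_top[of 0]
    by eventually_elim (simp add: field_simps)
  show "(\<lambda>n. prob {\<omega> \<in> space M. real n * x \<le> ?S n \<omega>}) \<longlonglongrightarrow> 0" if "c * y < x"
  proof (rule prob_tendsto_0)
    show "AE \<omega> in M. \<forall>\<^sub>F n in sequentially. \<omega> \<notin> {\<omega> \<in> space M. real n * x \<le> ?S n \<omega>}"
      using lim by eventually_elim (use below that in \<open>auto simp: not_le\<close>)
  qed measurable
  show "(\<lambda>n. prob {\<omega> \<in> space M. ?S n \<omega> < real n * x}) \<longlonglongrightarrow> 0" if "x < c * y"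
  proof (rule prob_tendsto_0)
    show "AE \<omega> in M. \<forall>\<^sub>F n in sequentially. \<omega> \<notin> {\<omega> \<in> space M. ?S n \<omega> < real n * x}"
      using lim by eventually_elim (use above that in \<open>auto simp: not_less\<close>)
  qed measurable
qed

lemma (in prob_space) prob_random_sum_less_bounds:
  fixes X :: "nat \<Rightarrow> 'a \<Rightarrow> real" and N :: "'a \<Rightarrow> nat"
  assumes X [measurable]: "\<And>i. X i \<in> borel_measurable M"
    and nonneg: "\<And>j \<omega>. \<omega> \<in> space M \<Longrightarrow> 0 \<le> X j \<omega>"
    and N [measurable]: "N \<in> measurable M (count_space UNIV)"
  shows "prob {\<omega> \<in> space M. N \<omega> \<le> m} - prob {\<omega> \<in> space M. t \<le> (\<Sum>j<m. X j \<omega>)}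
      \<le> prob {\<omega> \<in> space M. (\<Sum>j<N \<omega>. X j \<omega>) < t}"
    and "prob {\<omega> \<in> space M. (\<Sum>j<N \<omega>. X j \<omega>) < t}
      \<le> prob {\<omega> \<in> space M. N \<omega> \<le> m} + prob {\<omega> \<in> space M. (\<Sum>j<m. X j \<omega>) < t}"
proof -
  have mono: "(\<Sum>j<k. X j \<omega>) \<le> (\<Sum>j<l. X j \<omega>)" if "\<omega> \<in> space M" "k \<le> l" for \<omega> k l
    using that nonneg by (intro sum_mono2) auto
  have "prob {\<omega> \<in> space M. N \<omega> \<le> m} \<le>
      prob ({\<omega> \<in> space M. (\<Sum>j<N \<omega>. X j \<omega>) < t} \<union> {\<omega> \<in> space M. t \<le> (\<Sum>j<m. X j \<omega>)})"
  proof (rule finite_measure_mono)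
    show "{\<omega> \<in> space M. N \<omega> \<le> m} \<subseteq>
        {\<omega> \<in> space M. (\<Sum>j<N \<omega>. X j \<omega>) < t} \<union> {\<omega> \<in> space M. t \<le> (\<Sum>j<m. X j \<omega>)}"
    proof
      fix \<omega> assume "\<omega> \<in> {\<omega> \<in> space M. N \<omega> \<le> m}"
      then show "\<omega> \<in> {\<omega> \<in> space M. (\<Sum>j<N \<omega>. X j \<omega>) < t} \<union> {\<omega> \<in> space M. t \<le> (\<Sum>j<m. X j \<omega>)}"
        using mono[of \<omega> "N \<omega>" m] by auto
    qed
  qed measurable
  also have "\<dots> \<le> prob {\<omega> \<in> space M. (\<Sum>j<N \<omega>. X j \<omega>) < t} + prob {\<omega> \<in> space M. t \<le> (\<Sum>j<m. X j \<omega>)}"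
    by (rule measure_Un_le) measurable
  finally show "prob {\<omega> \<in> space M. N \<omega> \<le> m} - prob {\<omega> \<in> space M. t \<le> (\<Sum>j<m. X j \<omega>)}
      \<le> prob {\<omega> \<in> space M. (\<Sum>j<N \<omega>. X j \<omega>) < t}" by simp
  have "prob {\<omega> \<in> space M. (\<Sum>j<N \<omega>. X j \<omega>) < t} \<le>
      prob ({\<omega> \<in> space M. N \<omega> \<le> m} \<union> {\<omega> \<in> space M. (\<Sum>j<m. X j \<omega>) < t})"
  proof (rule finite_measure_mono)
    show "{\<omega> \<in> space M. (\<Sum>j<N \<omega>. X j \<omega>) < t} \<subseteq>
        {\<omega> \<in> space M. N \<omega> \<le> m} \<union> {\<omega> \<in> space M. (\<Sum>j<m. X j \<omega>) < t}"
    proof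
      fix \<omega> assume "\<omega> \<in> {\<omega> \<in> space M. (\<Sum>j<N \<omega>. X j \<omega>) < t}"
      then show "\<omega> \<in> {\<omega> \<in> space M. N \<omega> \<le> m} \<union> {\<omega> \<in> space M. (\<Sum>j<m. X j \<omega>) < t}"
        using mono[of \<omega> m "N \<omega>"] by (cases "N \<omega> \<le> m") auto
    qed
  qed measurable
  also have "\<dots> \<le> prob {\<omega> \<in> space M. N \<omega> \<le> m} + prob {\<omega> \<in> space M. (\<Sum>j<m. X j \<omega>) < t}"
    by (rule measure_Un_le) measurable
  finally show "prob {\<omega> \<in> space M. (\<Sum>j<N \<omega>. X j \<omega>) < t}
      \<le> prob {\<omega> \<in> space M. N \<omega> \<le> m} + prob {\<omega> \<in> space M. (\<Sum>j<m. X j \<omega>) < t}" .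
qed

lemma abs_diff_less_of_mono_endpoints:
  fixes H F :: "real \<Rightarrow> real"
  assumes "mono H" "mono F" and x: "p \<le> x" "x \<le> q"
    and "\<bar>H p - F p\<bar> < e" "\<bar>H q - F q\<bar> < e" "F q - F p < e"
  shows "\<bar>H x - F x\<bar> < 2 * e"
  using assms(5-) monoD[OF \<open>mono H\<close> x(1)] monoD[OF \<open>mono H\<close> x(2)]
    monoD[OF \<open>mono F\<close> x(1)] monoD[OF \<open>mono F\<close> x(2)]
  by linarith

lemma uniform_limit_Icc_of_mono:
  fixes F :: "real \<Rightarrow> real" and H :: "nat \<Rightarrow> real \<Rightarrow> real"
  assumes cont: "\<And>x. isCont F x" and mono_F: "mono F" and mono_H: "\<And>n. mono (H n)"
    and lim: "\<And>x. (\<lambda>n. H n x) \<longlonglongrightarrow> F x"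
  shows "uniform_limit {a..b} H F sequentially"
proof (rule uniform_limitI)
  fix e :: real assume e: "0 < e"
  have "\<exists>d>0. F (x + d) - F (x - d) < e / 2" for x
  proof -
    have "((\<lambda>d. F (x + d) - F (x - d)) \<longlongrightarrow> F (x + 0) - F (x - 0)) (at_right 0)"
      using cont by (intro tendsto_diff isCont_tendsto_compose[of _ F] tendsto_intros) auto
    then have "\<forall>\<^sub>F d in at_right 0. F (x + d) - F (x - d) < e / 2 \<and> 0 < d"
      using e by (intro eventually_conj order_tendstoD(2)) (auto simp: eventually_at_filter)
    then show ?thesis using eventually_happens trivial_limit_at_right_real by blast
  qed
  then obtain d where d: "\<And>x. 0 < d x" "\<And>x. F (x + d x) - F (x - d x) < e / 2" by metis
  have "{a..b} \<subseteq> (\<Union>x\<in>{a..b}. ball x (d x))" using d(1) by (auto intro!: bexI)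
  then obtain C where C: "finite C" "{a..b} \<subseteq> (\<Union>x\<in>C. ball x (d x))"
    using compactE_image[of "{a..b}" "{a..b}" "\<lambda>x. ball x (d x)"] by (metis compact_Icc open_ball)
  have "\<forall>\<^sub>F n in sequentially. \<bar>H n y - F y\<bar> < e / 2" for y
    using tendstoD[OF lim, of "e / 2" y] e by (simp add: dist_real_def)
  then have "\<forall>\<^sub>F n in sequentially. \<forall>x\<in>C. \<bar>H n (x - d x) - F (x - d x)\<bar> < e / 2 \<and>
      \<bar>H n (x + d x) - F (x + d x)\<bar> < e / 2"
    by (intro eventually_ball_finite[OF C(1)] ballI eventually_conj)
  then show "\<forall>\<^sub>F n in sequentially. \<forall>y\<in>{a..b}. dist (H n y) (F y) < e"
  proof eventually_elim
    case (elim n)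
    show ?case
    proof
      fix y assume "y \<in> {a..b}"
      then obtain x where x: "x \<in> C" "x - d x \<le> y" "y \<le> x + d x"
        using C(2) by (fastforce simp: dist_real_def)
      then show "dist (H n y) (F y) < e"
        using abs_diff_less_of_mono_endpoints[OF mono_H mono_F x(2,3), of n "e / 2"] elim d(2)[of x]
        by (auto simp: dist_real_def)
    qed
  qed
qed

lemma abs_diff_less_of_mono_tails:
  fixes H F :: "real \<Rightarrow> real"
  assumes "mono H" "mono F" and range_H: "H x \<in> {0..1}" and range_F: "F x \<in> {0..1}"
    and a: "F a < e" and b: "1 - e < F b"
    and close: "\<And>y. y \<in> {min a b..max a b} \<Longrightarrow> \<bar>H y - F y\<bar> < e"
  shows "\<bar>H x - F x\<bar> < 2 * e"
proof -
  have ends: "\<bar>H a - F a\<bar> < e" "\<bar>H b - F b\<bar> < e"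
    by (auto intro: close)
  consider (left) "x \<le> a" | (right) "b \<le> x" | (middle) "x \<in> {min a b..max a b}" by fastforce
  then show ?thesis
  proof cases
    case left
    then show ?thesis
      using monoD[OF \<open>mono F\<close> left] monoD[OF \<open>mono H\<close> left] range_H range_F ends a
      unfolding atLeastAtMost_iff by linarith
  next
    case right
    then show ?thesis
      using monoD[OF \<open>mono F\<close> right] monoD[OF \<open>mono H\<close> right] range_H range_F ends b
      unfolding atLeastAtMost_iff by linarith
  next
    case middle
    then show ?thesis using close[of x] by linarith
  qed
qed

theorem Polya_uniform_limit:
  fixes F :: "real \<Rightarrow> real" and H :: "nat \<Rightarrow> real \<Rightarrow> real"
  assumes cont: "\<And>x. isCont F x" and mono_H: "\<And>n. mono (H n)"
    and range_H: "\<And>n x. H n x \<in> {0..1}"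
    and at_bot: "(F \<longlongrightarrow> 0) at_bot" and at_top: "(F \<longlongrightarrow> 1) at_top"
    and lim: "\<And>x. (\<lambda>n. H n x) \<longlonglongrightarrow> F x"
  shows "uniform_limit UNIV H F sequentially"
proof (rule uniform_limitI)
  fix e :: real assume e: "0 < e"
  have mono_F: "mono F"
    using lim mono_H by (intro monoI LIMSEQ_le[of "\<lambda>n. H n _" _ "\<lambda>n. H n _"]) (auto dest: monoD)
  have range_F: "F x \<in> {0..1}" for x
    using LIMSEQ_le_const[OF lim] LIMSEQ_le_const2[OF lim] range_H by auto
  obtain a where a: "F a < e / 2"
    using order_tendstoD(2)[OF at_bot, of "e / 2"] e
      eventually_happens trivial_limit_at_bot_linorder
    by (metis half_gt_zero)
  obtain b where b: "1 - e / 2 < F b"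
    using order_tendstoD(1)[OF at_top, of "1 - e / 2"] e
      eventually_happens trivial_limit_at_top_linorder
    by (metis diff_less_eq half_gt_zero less_add_same_cancel1)
  have "\<forall>\<^sub>F n in sequentially. \<forall>y\<in>{min a b..max a b}. dist (H n y) (F y) < e / 2"
    using uniform_limit_Icc_of_mono[OF cont mono_F mono_H lim] e by (intro uniform_limitD) auto
  then show "\<forall>\<^sub>F n in sequentially. \<forall>x\<in>UNIV. dist (H n x) (F x) < e"
  proof eventually_elim
    case (elim n)
    then have "\<bar>H n x - F x\<bar> < 2 * (e / 2)" for x
      using mono_H mono_F range_H range_F a b
      by (intro abs_diff_less_of_mono_tails[of _ _ _ a _ b]) (auto simp: dist_real_def)
    then show ?case by (simp add: dist_real_def)
  qed
qed

lemma uniform_limit_imp_SUP_tendsto_0: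
  fixes f :: "'i \<Rightarrow> 'a \<Rightarrow> real"
  assumes lim: "uniform_limit S f g F" and "S \<noteq> {}"
  shows "((\<lambda>n. SUP x\<in>S. \<bar>f n x - g x\<bar>) \<longlongrightarrow> 0) F"
proof (rule tendstoI)
  fix e :: real assume e: "0 < e"
  obtain s where s: "s \<in> S" using \<open>S \<noteq> {}\<close> by blast
  have "\<forall>\<^sub>F n in F. \<forall>x\<in>S. dist (f n x) (g x) < e / 2"
    using lim e by (intro uniform_limitD) auto
  then show "\<forall>\<^sub>F n in F. dist (SUP x\<in>S. \<bar>f n x - g x\<bar>) 0 < e"
  proof eventually_elim
    case (elim n)
    then have bound: "\<bar>f n x - g x\<bar> \<le> e / 2" if "x \<in> S" for x
      using that by (force simp: dist_real_def)
    then have "(SUP x\<in>S. \<bar>f n x - g x\<bar>) \<le> e / 2"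
      using \<open>S \<noteq> {}\<close> by (intro cSUP_least)
    moreover have "\<bar>f n s - g s\<bar> \<le> (SUP x\<in>S. \<bar>f n x - g x\<bar>)"
      using s bound by (intro cSUP_upper bdd_aboveI2[of _ _ "e / 2"])
    ultimately show ?case using e by (simp add: dist_real_def)
  qed
qed

locale random_sum = prob_space M
  for M :: "'a measure" +
  fixes X :: "nat \<Rightarrow> 'a \<Rightarrow> real" and N :: "nat \<Rightarrow> 'a \<Rightarrow> nat" and c :: real
  assumes X [measurable]: "\<And>i. X i \<in> borel_measurable M"
    and X_nonneg: "\<And>j \<omega>. \<omega> \<in> space M \<Longrightarrow> 0 \<le> X j \<omega>"
    and c_pos: "0 < c"
    and slln: "AE \<omega> in M. (\<lambda>n. (\<Sum>j<n. X j \<omega>) / real n) \<longlonglongrightarrow> c"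
    and N [measurable]: "\<And>n. N n \<in> measurable M (count_space UNIV)"
begin

abbreviation random_sum_cdf :: "nat \<Rightarrow> real \<Rightarrow> real" where
  "random_sum_cdf n x \<equiv> prob {\<omega> \<in> space M. (\<Sum>j<N n \<omega>. X j \<omega>) < real n * x}"

end

locale random_sum_convergence = random_sum M X N c
  for M :: "'a measure" and X N and c :: real +
  fixes D :: "real measure"
  assumes real_distribution_D: "real_distribution D"
    and weak_conv_N: "weak_conv_m (\<lambda>n. distr M borel (\<lambda>\<omega>. real (N n \<omega>) / real n)) D"
    and isCont_cdf_D: "\<And>y. isCont (cdf D) y"
begin

lemma prob_N_le_tendsto:
  assumes "0 \<le> y"
  shows "(\<lambda>n. prob {\<omega> \<in> space M. N n \<omega> \<le> nat \<lfloor>real n * y\<rfloor>}) \<longlonglongrightarrow> cdf D y"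
proof (rule Lim_transform_eventually)
  show "(\<lambda>n. prob {\<omega> \<in> space M. real (N n \<omega>) / real n \<le> y}) \<longlonglongrightarrow> cdf D y"
    using weak_conv_N isCont_cdf_D
    by (simp add: weak_conv_m_def weak_conv_def cdf_def measure_distr
        vimage_def Int_def conj_commute)
  have le_iff: "real k / real n \<le> y \<longleftrightarrow> k \<le> nat \<lfloor>real n * y\<rfloor>" if "0 < n" for k n
    using that assms by (simp add: le_nat_iff le_floor_iff field_simps)
  show "\<forall>\<^sub>F n in sequentially. prob {\<omega> \<in> space M. real (N n \<omega>) / real n \<le> y} =
      prob {\<omega> \<in> space M. N n \<omega> \<le> nat \<lfloor>real n * y\<rfloor>}"
    using eventually_gt_at_top[of 0] by eventually_elim (simp add: le_iff)
qed

lemma cdf_D_eq_0_of_neg: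
  assumes "y < 0"
  shows "cdf D y = 0"
proof -
  have "\<not> real (N n \<omega>) / real n \<le> y" for n \<omega>
    using assms divide_nonneg_nonneg[of "real (N n \<omega>)" "real n"] by linarith
  then have "cdf (distr M borel (\<lambda>\<omega>. real (N n \<omega>) / real n)) y = 0" for n
    by (simp add: cdf_def measure_distr vimage_def)
  moreover have "(\<lambda>n. cdf (distr M borel (\<lambda>\<omega>. real (N n \<omega>) / real n)) y) \<longlonglongrightarrow> cdf D y"
    using weak_conv_N isCont_cdf_D by (simp add: weak_conv_m_def weak_conv_def)
  ultimately show ?thesis by (simp add: LIMSEQ_const_iff)
qed

lemma eventually_less_random_sum_cdf:
  assumes a: "a < cdf D y" and y: "c * y < x"
  shows "\<forall>\<^sub>F n in sequentially. a < random_sum_cdf n x"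
proof (cases "0 \<le> y")
  case True
  have "(\<lambda>n. prob {\<omega> \<in> space M. N n \<omega> \<le> nat \<lfloor>real n * y\<rfloor>} -
      prob {\<omega> \<in> space M. real n * x \<le> (\<Sum>j<nat \<lfloor>real n * y\<rfloor>. X j \<omega>)}) \<longlonglongrightarrow> cdf D y - 0"
    by (intro tendsto_diff prob_N_le_tendsto True prob_partial_sum_tendsto_0(1)[OF X slln True y])
  from order_tendstoD(1)[OF this, of a] a show ?thesis
    by (auto elim!: eventually_mono
        intro: less_le_trans prob_random_sum_less_bounds(1) X X_nonneg N)
next
  case False
  then have "a < 0" using a cdf_D_eq_0_of_neg by simp
  then show ?thesis by (intro always_eventually allI less_le_trans[OF _ measure_nonneg])
qed

lemma eventually_random_sum_cdf_less:
  assumes a: "cdf D y < a" and y: "x < c * y"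
  shows "\<forall>\<^sub>F n in sequentially. random_sum_cdf n x < a"
proof (cases "0 \<le> y")
  case True
  have "(\<lambda>n. prob {\<omega> \<in> space M. N n \<omega> \<le> nat \<lfloor>real n * y\<rfloor>} +
      prob {\<omega> \<in> space M. (\<Sum>j<nat \<lfloor>real n * y\<rfloor>. X j \<omega>) < real n * x}) \<longlonglongrightarrow> cdf D y + 0"
    by (intro tendsto_add prob_N_le_tendsto True prob_partial_sum_tendsto_0(2)[OF X slln True y])
  from order_tendstoD(2)[OF this, of a] a show ?thesis
    by (auto elim!: eventually_mono
        intro: le_less_trans[OF prob_random_sum_less_bounds(2)] X X_nonneg N)
next
  case False
  then have "x < 0" using y c_pos by (meson less_trans mult_pos_neg not_le)
  then have "\<not> (\<Sum>j<N n \<omega>. X j \<omega>) < real n * x" if "\<omega> \<in> space M" for n \<omega>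
    using sum_nonneg[of "{..<N n \<omega>}" "\<lambda>j. X j \<omega>"] X_nonneg[OF that]
      mult_nonneg_nonpos[of "real n" x] by force
  then have "random_sum_cdf n x = 0" for n
    by (metis (no_types, lifting) Collect_empty_eq measure_empty)
  then show ?thesis using a False cdf_D_eq_0_of_neg by simp
qed

theorem random_sum_cdf_tendsto:
  "(\<lambda>n. random_sum_cdf n x) \<longlonglongrightarrow> cdf D (x / c)"
proof (rule order_tendstoI)
  have cdf_tendsto: "(cdf D \<longlongrightarrow> cdf D (x / c)) (at (x / c) within S)" for S
    using isCont_cdf_D continuous_at_imp_continuous_at_within continuous_within by blast
  show "\<forall>\<^sub>F n in sequentially. a < random_sum_cdf n x" if "a < cdf D (x / c)" for a
  proof -
    have "\<forall>\<^sub>F y in at_left (x / c). a < cdf D y \<and> y < x / c"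
      by (intro eventually_conj order_tendstoD(1)[OF cdf_tendsto that])
         (simp add: eventually_at_filter)
    then obtain y where "a < cdf D y" "y < x / c"
      using eventually_happens trivial_limit_at_left_real by blast
    then show ?thesis
      using c_pos by (intro eventually_less_random_sum_cdf) (simp_all add: field_simps)
  qed
  show "\<forall>\<^sub>F n in sequentially. random_sum_cdf n x < a" if "cdf D (x / c) < a" for a
  proof -
    have "\<forall>\<^sub>F y in at_right (x / c). cdf D y < a \<and> x / c < y"
      by (intro eventually_conj order_tendstoD(2)[OF cdf_tendsto that])
         (simp add: eventually_at_filter)
    then obtain y where "cdf D y < a" "x / c < y"
      using eventually_happens trivial_limit_at_right_real by blast
    then show ?thesis
      using c_pos by (intro eventually_random_sum_cdf_less) (simp_all add: field_simps)
  qed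
qed

theorem uniform_limit_random_sum_cdf:
  "uniform_limit UNIV random_sum_cdf (\<lambda>x. cdf D (x / c)) sequentially"
proof (rule Polya_uniform_limit)
  interpret D: real_distribution D by (rule real_distribution_D)
  show "isCont (\<lambda>x. cdf D (x / c)) x" for x
    using c_pos by (intro isCont_o2[OF _ isCont_cdf_D] continuous_intros) simp
  have "filterlim (\<lambda>x. x / c) at_bot at_bot" "filterlim (\<lambda>x. x / c) at_top at_top"
    using c_pos by real_asymp+
  then show "((\<lambda>x. cdf D (x / c)) \<longlongrightarrow> 0) at_bot" "((\<lambda>x. cdf D (x / c)) \<longlongrightarrow> 1) at_top"
    by (auto intro: filterlim_compose[OF D.cdf_lim_at_bot]
        filterlim_compose[OF D.cdf_lim_at_top_prob])
  show "mono (random_sum_cdf n)" for n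
  proof (rule monoI)
    fix x y :: real assume "x \<le> y"
    then have "real n * x \<le> real n * y" by (intro mult_left_mono) auto
    then show "random_sum_cdf n x \<le> random_sum_cdf n y"
      by (intro finite_measure_mono) auto
  qed
qed (simp_all add: random_sum_cdf_tendsto)

end

lemma cdf_gg_distribution_eq_interval_integral:
  assumes r: "0 < r" and \<alpha>: "\<alpha> \<noteq> 0" and c: "0 < c" and x: "0 \<le> x"
  shows "cdf (gg_distribution r \<alpha> 1) (x / c) = (LBINT z=0..x. gg_density r \<alpha> (c powr - \<alpha>) z)"
proof -
  have "(*) c -` {..x} = {..x / c}" using c by (auto simp: pos_le_divide_eq mult.commute)
  then have "cdf (gg_distribution r \<alpha> 1) (x / c) =
      cdf (distr (gg_distribution r \<alpha> 1) borel ((*) c)) x"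
    by (simp add: cdf_def measure_distr)
  also have "\<dots> = cdf (gg_distribution r \<alpha> (c powr - \<alpha>)) x"
    using r \<alpha> c by (simp add: distr_gg_distribution_scale)
  also have "\<dots> = (LBINT z=0..x. gg_density r \<alpha> (c powr - \<alpha>) z)"
  proof (rule cdf_density_eq_interval_integral)
    show "integrable lborel (gg_density r \<alpha> (c powr - \<alpha>))"
      using r \<alpha> c by (intro integrableI_nonneg) (auto simp: nn_integral_gg_density)
  qed (use r x in \<open>auto simp: gg_density_def\<close>)
  finally show ?thesis .
qed

locale gnb_random_sum = random_sum M X N c
  for M :: "'a measure" and X N and c :: real +
  fixes r \<alpha> :: real
  assumes r_pos: "0 < r" and \<alpha>_nz: "\<alpha> \<noteq> 0"
    and N_distr: "\<And>n k. n \<ge> 1 \<Longrightarrow>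
      prob {\<omega> \<in> space M. N n \<omega> = k} = gnb_pmf r \<alpha> (real n powr - \<alpha>) k"

sublocale gnb_random_sum \<subseteq> random_sum_convergence M X N c "gg_distribution r \<alpha> 1"
proof (intro random_sum_convergence.intro random_sum_convergence_axioms.intro random_sum_axioms)
  show D: "real_distribution (gg_distribution r \<alpha> 1)"
    using r_pos \<alpha>_nz by (intro real_distribution_gg) auto
  show "isCont (cdf (gg_distribution r \<alpha> 1)) y" for y
    by (rule isCont_cdf_density_lborel[OF D]) measurable
  show "weak_conv_m (\<lambda>n. distr M borel (\<lambda>\<omega>. real (N n \<omega>) / real n)) (gg_distribution r \<alpha> 1)"
  proof (rule weak_conv_scaled_mixed_Poisson[OF N D])
    show "AE y in gg_distribution r \<alpha> 1. 0 \<le> y"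
      using AE_gg_distribution_pos[of r \<alpha> 1] by eventually_elim simp
    show "prob {\<omega> \<in> space M. N n \<omega> = k} =
        mixed_Poisson_pmf (distr (gg_distribution r \<alpha> 1) borel ((*) (real n))) k"
      if "n \<ge> 1" for n k
      using that r_pos \<alpha>_nz
      by (simp add: N_distr gnb_pmf_eq_mixed_Poisson_pmf distr_gg_distribution_scale)
  qed
qed

theorem (in gnb_random_sum) SUP_random_sum_cdf_diff_tendsto_0:
  "(\<lambda>n. SUP x\<in>{0..}. \<bar>random_sum_cdf n x - (LBINT z=0..x. gg_density r \<alpha> (c powr - \<alpha>) z)\<bar>) \<longlonglongrightarrow> 0"
proof -
  have "uniform_limit {0..} random_sum_cdf (\<lambda>x. cdf (gg_distribution r \<alpha> 1) (x / c)) sequentially"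
    using uniform_limit_random_sum_cdf by (rule uniform_limit_on_subset) simp
  then have "uniform_limit {0..} random_sum_cdf
      (\<lambda>x. LBINT z=0..x. gg_density r \<alpha> (c powr - \<alpha>) z) sequentially"
    by (rule uniform_limit_cong'[THEN iffD1, rotated -1])
       (simp_all add: cdf_gg_distribution_eq_interval_integral[OF r_pos \<alpha>_nz c_pos])
  then show ?thesis by (rule uniform_limit_imp_SUP_tendsto_0) simp
qed

section \<open>Bounded holomorphic functions on the upper half plane\<close>

lemma has_bochner_integral_Cauchy_kernel:
  fixes v :: real
  assumes "v > 0"
  shows "has_bochner_integral lborel (\<lambda>t. 1 / (t\<^sup>2 + v\<^sup>2)) (pi / v)"
proof -
  have "has_bochner_integral lborel (\<lambda>x::real. inverse (1 + x\<^sup>2)) pi"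
    using integrable_inverse_1_plus_square LBINT_inverse_1_plus_square
    by (simp add: has_bochner_integral_iff set_integrable_def
        interval_lebesgue_integral_def set_lebesgue_integral_def)
  then have "has_bochner_integral lborel (\<lambda>x::real. inverse (1 + (0 + 1 / v * x)\<^sup>2))
      (pi /\<^sub>R \<bar>1 / v\<bar>)"
    by (subst lborel_has_bochner_integral_real_affine_iff[where c="v" and t=0])
       (use assms in \<open>auto simp: has_bochner_integral_iff\<close>)
  then have "has_bochner_integral lborel (\<lambda>x::real. inverse (1 + (x / v)\<^sup>2) * (1 / v\<^sup>2))
      ((pi * v) * (1 / v\<^sup>2))"
    using assms by (intro has_bochner_integral_mult_left) (auto simp: mult.commute)
  moreover have "inverse (1 + (x / v)\<^sup>2) * (1 / v\<^sup>2) = 1 / (x\<^sup>2 + v\<^sup>2)" for x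
    using assms by (simp add: power_divide field_simps)
  ultimately show ?thesis using assms by (simp add: power2_eq_square)
qed

lemma tendsto_integral_symmetric_interval:
  fixes f :: "real \<Rightarrow> 'a::euclidean_space"
  assumes f: "integrable lborel f"
  shows "((\<lambda>R. integral {-R..R} f) \<longlongrightarrow> (\<integral>t. f t \<partial>lborel)) at_top"
proof -
  have "((\<lambda>R. \<integral>t. indicator {-R..R} t *\<^sub>R f t \<partial>lborel) \<longlongrightarrow> (\<integral>t. f t \<partial>lborel)) at_top"
  proof (rule integral_dominated_convergence_at_top)
    show "integrable lborel (\<lambda>t. norm (f t))" using f by auto
    show "\<forall>\<^sub>F R in at_top. AE t in lborel. norm (indicator {-R..R} t *\<^sub>R f t) \<le> norm (f t)"
      by (auto simp: indicator_def)
    have "((\<lambda>R. indicator {-R..R} t *\<^sub>R f t) \<longlongrightarrow> f t) at_top" for t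
      by (rule tendsto_eventually, rule eventually_mono[OF eventually_ge_at_top[of "\<bar>t\<bar>"]])
         (auto simp: indicator_def)
    then show "AE t in lborel. ((\<lambda>R. indicator {-R..R} t *\<^sub>R f t) \<longlongrightarrow> f t) at_top" by simp
  qed (use f in auto)
  moreover have "(\<integral>t. indicator {-R..R} t *\<^sub>R f t \<partial>lborel) = integral {-R..R} f" for R
    using f integrable_mult_indicator[of "{-R..R}" lborel f]
    by (subst set_borel_integral_eq_integral(2)[symmetric])
       (auto simp: set_lebesgue_integral_def set_integrable_def)
  ultimately show ?thesis by simp
qed

abbreviation half_disc_path :: "real \<Rightarrow> real \<Rightarrow> complex" where
  "half_disc_path R \<equiv> linepath (of_real (-R)) (of_real R) +++ part_circlepath 0 R 0 pi"

lemma path_image_half_disc_path: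
  assumes "0 < R"
  shows "path_image (half_disc_path R) \<subseteq> {z. 0 \<le> Im z} \<inter> ({z. Im z = 0} \<union> {z. norm z = R})"
proof -
  have "path_image (part_circlepath 0 R 0 pi) \<subseteq> {z. 0 \<le> Im z \<and> norm z = R}"
    using assms by (auto simp: path_image_part_circlepath Im_exp sin_ge_zero norm_mult)
  moreover have "path_image (linepath (of_real (-R)) (of_real R :: complex)) \<subseteq> {z. Im z = 0}"
    using closed_segment_same_Im[of "of_real (-R)" "of_real R :: complex"] by auto
  ultimately show ?thesis by (auto simp: path_image_join)
qed

lemma norm_integral_symmetric_interval_le:
  assumes contour: "(g has_contour_integral 0) (half_disc_path R)"
    and R: "0 < R" and C: "0 \<le> C"
    and bound: "\<And>z. 0 \<le> Im z \<Longrightarrow> norm z = R \<Longrightarrow> norm (g z) \<le> C"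
  shows "norm (integral {-R..R} (\<lambda>t. g (of_real t))) \<le> C * R * pi"
proof -
  let ?l = "linepath (of_real (-R)) (of_real R :: complex)" and ?c = "part_circlepath 0 R 0 pi"
  have "g contour_integrable_on half_disc_path R"
    using contour by (rule has_contour_integral_integrable)
  then have ci: "g contour_integrable_on ?l" "g contour_integrable_on ?c"
    by (simp_all add: contour_integrable_join)
  have "contour_integral ?l g + contour_integral ?c g = 0"
    using contour contour_integral_unique contour_integral_join[OF ci] by simp
  then have "norm (contour_integral ?l g) = norm (contour_integral ?c g)"
    by (simp add: add_eq_0_iff norm_minus_commute)
  moreover have "contour_integral ?l g = integral {-R..R} (\<lambda>t. g (of_real t))"
    using R by (subst contour_integral_linepath_Reals_eq) auto
  moreover have "norm (contour_integral ?c g) \<le> C * R * \<bar>pi - 0\<bar>"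
  proof (rule contour_integral_bound_part_circlepath[OF ci(2) C])
    fix z assume "z \<in> path_image ?c"
    then have "z \<in> {z. 0 \<le> Im z \<and> norm z = R}"
      using R by (auto simp: path_image_part_circlepath Im_exp sin_ge_zero norm_mult)
    then show "norm (g z) \<le> C" using bound by simp
  qed (use R in auto)
  ultimately show ?thesis by simp
qed

locale bounded_halfplane_function =
  fixes F :: "complex \<Rightarrow> complex" and B :: real
  assumes continuous: "continuous_on {z. 0 \<le> Im z} F"
    and holomorphic: "F holomorphic_on {z. 0 < Im z}"
    and bounded: "\<And>z. 0 \<le> Im z \<Longrightarrow> norm (F z) \<le> B"
begin

lemma bound_nonneg: "0 \<le> B"
  using order_trans[OF norm_ge_zero bounded[of 0]] by simp

lemma borel_measurable_on_reals [measurable]: "(\<lambda>t. F (of_real t)) \<in> borel_measurable borel"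
  by (intro borel_measurable_continuous_onI continuous_on_compose2[OF continuous])
     (auto intro!: continuous_intros)

lemma integrable_mult_on_reals:
  fixes k :: "real \<Rightarrow> complex"
  assumes "integrable lborel k"
  shows "integrable lborel (\<lambda>t. F (of_real t) * k t)"
proof (rule Bochner_Integration.integrable_bound)
  show "integrable lborel (\<lambda>t. of_real B * k t)" using assms by auto
  show "(\<lambda>t. F (of_real t) * k t) \<in> borel_measurable lborel"
    using assms by (intro borel_measurable_times) auto
  show "AE t in lborel. norm (F (of_real t) * k t) \<le> norm (of_real B * k t)"
    by (intro AE_I2) (auto simp: norm_mult intro!: mult_right_mono order_trans[OF bounded])
qed

lemma integrable_Cauchy_kernel:
  "v > 0 \<Longrightarrow> integrable lborel (\<lambda>t. F (of_real t) / of_real (t\<^sup>2 + v\<^sup>2))"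
  using integrable_mult_on_reals[OF integrable_of_real, of "\<lambda>t. 1 / (t\<^sup>2 + v\<^sup>2)"]
    has_bochner_integral_Cauchy_kernel[of v]
  by (simp add: has_bochner_integral_iff)

text \<open>Subtracting the value at the pole makes the residue vanish, whatever the winding number.\<close>
lemma has_contour_integral_half_disc_path:
  assumes v: "0 < v" and R: "v < R"
  shows "((\<lambda>z. (F z - F (\<i> * of_real v)) / (z\<^sup>2 + of_real (v\<^sup>2))) has_contour_integral 0)
    (half_disc_path R)"
proof -
  define a where "a = \<i> * of_real v"
  have nz: "z + a \<noteq> 0" if "0 \<le> Im z" for z
    using that v by (auto simp: a_def complex_eq_iff)
  have int: "interior {z. 0 \<le> Im z} = {z. 0 < Im z}"
    using interior_halfspace_ge[of \<i> 0] by (simp add: inner_complex_def)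
  let ?G = "\<lambda>z. (F z - F a) / (z + a)"
  have "((\<lambda>z. ?G z / (z - a)) has_contour_integral
      2 * pi * \<i> * winding_number (half_disc_path R) a * ?G a) (half_disc_path R)"
  proof (rule Cauchy_integral_formula_weak[of "{z. 0 \<le> Im z}" "{}"])
    show "continuous_on {z. 0 \<le> Im z} ?G"
      using nz by (intro continuous_intros continuous) auto
    have "?G holomorphic_on {z. 0 < Im z}"
      using nz by (intro holomorphic_intros holomorphic) auto
    then show "?G field_differentiable at z" if "z \<in> interior {z. 0 \<le> Im z} - {}" for z
      using that holomorphic_on_imp_differentiable_at[OF _ open_halfspace_Im_gt] by (auto simp: int)
    show "path_image (half_disc_path R) \<subseteq> {z. 0 \<le> Im z} - {a}"
      using path_image_half_disc_path[of R] v R by (auto simp: a_def norm_mult)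
    show "a \<in> interior {z. 0 \<le> Im z} - {}" using v by (simp add: int a_def)
  qed (auto intro!: valid_path_join simp: convex_halfspace_Im_ge)
  moreover have "(z + a) * (z - a) = z\<^sup>2 + of_real (v\<^sup>2)" for z
    by (simp add: a_def power2_eq_square algebra_simps)
  ultimately show ?thesis by (simp flip: a_def)
qed

lemma norm_integral_symmetric_interval_quotient_le:
  assumes v: "0 < v" and R: "v < R"
  shows "norm (integral {-R..R}
      (\<lambda>t. (F (of_real t) - F (\<i> * of_real v)) / ((of_real t)\<^sup>2 + of_real (v\<^sup>2))))
    \<le> 2 * B / (R\<^sup>2 - v\<^sup>2) * R * pi"
proof (rule norm_integral_symmetric_interval_le[OF has_contour_integral_half_disc_path[OF v R]])
  have Rv: "v\<^sup>2 < R\<^sup>2" using R v by (intro power_strict_mono) auto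
  then show "0 \<le> 2 * B / (R\<^sup>2 - v\<^sup>2)" using bound_nonneg by simp
  fix z assume z: "0 \<le> Im z" "norm z = R"
  have "norm (F z - F (\<i> * of_real v)) \<le> 2 * B"
    using norm_triangle_ineq4[of "F z" "F (\<i> * of_real v)"] bounded[OF z(1)]
      bounded[of "\<i> * of_real v"] v by simp
  moreover have "R\<^sup>2 - v\<^sup>2 \<le> norm (z\<^sup>2 + of_real (v\<^sup>2))"
    using norm_diff_ineq[of "z\<^sup>2" "of_real (v\<^sup>2)"] z(2) by (simp add: norm_power)
  ultimately show "norm ((F z - F (\<i> * of_real v)) / (z\<^sup>2 + of_real (v\<^sup>2))) \<le> 2 * B / (R\<^sup>2 - v\<^sup>2)"
    using Rv bound_nonneg by (auto simp: norm_divide intro!: frac_le)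
qed (use v R in auto)

theorem Poisson_formula:
  assumes v: "v > 0"
  shows "(\<integral>t. F (of_real t) / of_real (t\<^sup>2 + v\<^sup>2) \<partial>lborel) = of_real (pi / v) * F (\<i> * of_real v)"
proof -
  define a where "a = \<i> * of_real v"
  define G where "G = (\<lambda>z. (F z - F a) / (z\<^sup>2 + of_real (v\<^sup>2)))"
  have G_real: "G (of_real t) =
      F (of_real t) / of_real (t\<^sup>2 + v\<^sup>2) - F a * of_real (1 / (t\<^sup>2 + v\<^sup>2))" for t
    by (simp add: G_def diff_divide_distrib)
  have kernel: "has_bochner_integral lborel (\<lambda>t. F a * of_real (1 / (t\<^sup>2 + v\<^sup>2)))
      (F a * of_real (pi / v))"
    using has_bochner_integral_Cauchy_kernel[OF v]
    by (intro has_bochner_integral_mult_right has_bochner_integral_of_real)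
  then have G_int: "integrable lborel (\<lambda>t. G (of_real t))"
    unfolding G_real using integrable_Cauchy_kernel[OF v] by (auto simp: has_bochner_integral_iff)
  have "((\<lambda>R. integral {-R..R} (\<lambda>t. G (of_real t))) \<longlongrightarrow> 0) at_top"
  proof (rule Lim_null_comparison)
    show "\<forall>\<^sub>F R in at_top. norm (integral {-R..R} (\<lambda>t. G (of_real t)))
        \<le> 2 * B / (R\<^sup>2 - v\<^sup>2) * R * pi"
      unfolding G_def a_def
      using eventually_gt_at_top[of v]
      by eventually_elim (rule norm_integral_symmetric_interval_quotient_le[OF v])
    show "((\<lambda>R. 2 * B / (R\<^sup>2 - v\<^sup>2) * R * pi) \<longlongrightarrow> 0) at_top"
      by real_asymp
  qed
  then have "(\<integral>t. G (of_real t) \<partial>lborel) = 0"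
    using tendsto_integral_symmetric_interval[OF G_int]
      tendsto_unique trivial_limit_at_top_linorder by blast
  then show ?thesis
    unfolding G_real using kernel integrable_Cauchy_kernel[OF v]
    by (simp add: has_bochner_integral_iff a_def mult.commute)
qed

end

text \<open>The factor \<open>(z - \<i> * p) / (z + \<i> * q)\<close> cancels the pole \<open>\<i> * p\<close> of the
  Cauchy kernel and turns its other pole into a pole at \<open>- \<i> * q\<close>.\<close>
lemma (in bounded_halfplane_function) bounded_halfplane_function_mult_quotient:
  assumes p: "0 < p" and pq: "p \<le> q"
  shows "bounded_halfplane_function (\<lambda>z. F z * ((z - \<i> * of_real p) / (z + \<i> * of_real q))) B"
proof
  have nz: "z + \<i> * of_real q \<noteq> 0" if "0 \<le> Im z" for z
    using that p pq by (auto simp: complex_eq_iff)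
  show "continuous_on {z. 0 \<le> Im z} (\<lambda>z. F z * ((z - \<i> * of_real p) / (z + \<i> * of_real q)))"
    using nz by (intro continuous_intros continuous) auto
  show "(\<lambda>z. F z * ((z - \<i> * of_real p) / (z + \<i> * of_real q))) holomorphic_on {z. 0 < Im z}"
    using nz by (intro holomorphic_intros holomorphic) auto
  fix z assume z: "0 \<le> Im z"
  have "norm (z - \<i> * of_real p) \<le> norm (z + \<i> * of_real q)"
  proof -
    have "\<bar>Im z - p\<bar> \<le> \<bar>Im z + q\<bar>" using z p pq by auto
    then show ?thesis by (simp add: cmod_def abs_le_square_iff)
  qed
  then have "norm ((z - \<i> * of_real p) / (z + \<i> * of_real q)) \<le> 1"
    using nz[OF z] by (simp add: norm_divide)
  then show "norm (F z * ((z - \<i> * of_real p) / (z + \<i> * of_real q))) \<le> B"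
    unfolding norm_mult using mult_mono[OF bounded[OF z] _ bound_nonneg norm_ge_zero] by fastforce
qed

lemma of_real_sum_power2_eq_mult:
  "complex_of_real (t\<^sup>2 + v\<^sup>2) = (of_real t - \<i> * of_real v) * (of_real t + \<i> * of_real v)"
  by (simp add: power2_eq_square algebra_simps)

lemma of_real_add_imaginary_neq_0:
  "v \<noteq> 0 \<Longrightarrow> complex_of_real t + \<i> * of_real v \<noteq> 0"
  "v \<noteq> 0 \<Longrightarrow> complex_of_real t - \<i> * of_real v \<noteq> 0"
  by (auto simp: complex_eq_iff)

lemma (in bounded_halfplane_function) has_bochner_integral_lower_poles:
  assumes p: "0 < p" and pq: "p \<le> q"
  shows "has_bochner_integral lborel
    (\<lambda>t. F (of_real t) / ((of_real t + \<i> * of_real p) * (of_real t + \<i> * of_real q))) 0"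
proof -
  interpret G: bounded_halfplane_function "\<lambda>z. F z * ((z - \<i> * of_real p) / (z + \<i> * of_real q))" B
    using p pq by (rule bounded_halfplane_function_mult_quotient)
  have "F (of_real t) * ((of_real t - \<i> * of_real p) / (of_real t + \<i> * of_real q)) /
      of_real (t\<^sup>2 + p\<^sup>2) =
     F (of_real t) / ((of_real t + \<i> * of_real p) * (of_real t + \<i> * of_real q))" for t
    unfolding of_real_sum_power2_eq_mult using p pq
    by (simp add: of_real_add_imaginary_neq_0 divide_simps)
  then show ?thesis
    using G.integrable_Cauchy_kernel[OF p] G.Poisson_formula[OF p]
    by (simp add: has_bochner_integral_iff)
qed

lemma upper_poles_partial_fractions:
  fixes p q t :: real and w :: complex
  assumes "0 < p" "p < q"
  shows "w / ((of_real t - \<i> * of_real p) * (of_real t - \<i> * of_real q)) =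
    of_real (2 * q / (q - p)) * (w / of_real (t\<^sup>2 + q\<^sup>2))
    - of_real (2 * p / (q - p)) * (w / of_real (t\<^sup>2 + p\<^sup>2))
    - w / ((of_real t + \<i> * of_real p) * (of_real t + \<i> * of_real q))"
proof -
  have "of_real p \<noteq> (of_real q :: complex)" using assms by simp
  then show ?thesis
    unfolding of_real_sum_power2_eq_mult of_real_divide of_real_mult of_real_diff
    using assms by (simp add: of_real_add_imaginary_neq_0 divide_simps) (simp add: algebra_simps)
qed

lemma (in bounded_halfplane_function) has_bochner_integral_upper_poles:
  assumes p: "0 < p" and pq: "p < q"
  shows "has_bochner_integral lborel
    (\<lambda>t. F (of_real t) / ((of_real t - \<i> * of_real p) * (of_real t - \<i> * of_real q)))
    (of_real (2 * pi / (q - p)) * (F (\<i> * of_real q) - F (\<i> * of_real p)))"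
proof -
  have Cauchy: "has_bochner_integral lborel
      (\<lambda>t. of_real (2 * v / (q - p)) * (F (of_real t) / of_real (t\<^sup>2 + v\<^sup>2)))
      (of_real (2 * v / (q - p)) * (of_real (pi / v) * F (\<i> * of_real v)))" if "0 < v" for v
    using integrable_Cauchy_kernel[OF that] Poisson_formula[OF that]
    by (intro has_bochner_integral_mult_right) (simp add: has_bochner_integral_iff)
  have "has_bochner_integral lborel
    (\<lambda>t. F (of_real t) / ((of_real t - \<i> * of_real p) * (of_real t - \<i> * of_real q)))
    (of_real (2 * q / (q - p)) * (of_real (pi / q) * F (\<i> * of_real q)) -
     of_real (2 * p / (q - p)) * (of_real (pi / p) * F (\<i> * of_real p)) - 0)"
    unfolding upper_poles_partial_fractions[OF p pq] using p pq
    by (intro has_bochner_integral_diff Cauchy has_bochner_integral_lower_poles) auto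
  then show ?thesis using p pq by (simp add: right_diff_distrib mult.assoc[symmetric])
qed

section \<open>Characteristic functions extending to the half plane\<close>

lemma bounded_halfplane_function_iexp:
  assumes "x \<ge> 0"
  shows "bounded_halfplane_function (\<lambda>z. exp (\<i> * z * of_real x)) 1"
proof
  show "norm (exp (\<i> * z * of_real x)) \<le> 1" if "0 \<le> Im z" for z
    using that assms by (simp add: mult_nonneg_nonneg)
qed (auto intro!: continuous_intros holomorphic_intros)

lemma exp_imaginary_axis: "exp (\<i> * (\<i> * of_real v) * of_real x) = complex_of_real (exp (- v * x))"
  by (simp add: exp_of_real[symmetric])

lemma lborel_integral_reflect:
  fixes f :: "real \<Rightarrow> 'a::{banach, second_countable_topology}"
  shows "(\<integral>t. f t \<partial>lborel) = (\<integral>t. f (- t) \<partial>lborel)"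
  using lborel_integral_real_affine[of "- 1" f 0] by simp

lemma Fourier_Cauchy_kernel:
  fixes v x :: real
  assumes v: "v > 0"
  shows "(\<integral>t. iexp (t * x) / of_real (t\<^sup>2 + v\<^sup>2) \<partial>lborel) = of_real (pi / v * exp (- v * \<bar>x\<bar>))"
proof -
  interpret E: bounded_halfplane_function "\<lambda>z. exp (\<i> * z * of_real \<bar>x\<bar>)" 1
    by (rule bounded_halfplane_function_iexp) simp
  have "(\<integral>t. iexp (t * x) / of_real (t\<^sup>2 + v\<^sup>2) \<partial>lborel) =
      (\<integral>t. iexp (t * \<bar>x\<bar>) / of_real (t\<^sup>2 + v\<^sup>2) \<partial>lborel)"
    using lborel_integral_reflect[of "\<lambda>t. iexp (t * x) / of_real (t\<^sup>2 + v\<^sup>2)"]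
    by (cases "0 \<le> x") simp_all
  also have "\<dots> = of_real (pi / v * exp (- v * \<bar>x\<bar>))"
    using E.Poisson_formula[OF v] unfolding exp_imaginary_axis by (simp add: mult.assoc)
  finally show ?thesis .
qed

lemma Fourier_lower_poles_kernel:
  fixes p q x :: real
  assumes p: "0 < p" and pq: "p < q"
  shows "(\<integral>t. iexp (t * x) / ((of_real t + \<i> * of_real p) * (of_real t + \<i> * of_real q)) \<partial>lborel) =
    (if 0 \<le> x then 0 else of_real (2 * pi / (q - p) * (exp (q * x) - exp (p * x))))"
proof -
  interpret E: bounded_halfplane_function "\<lambda>z. exp (\<i> * z * of_real \<bar>x\<bar>)" 1
    by (rule bounded_halfplane_function_iexp) simp
  show ?thesis
  proof (cases "0 \<le> x")
    case True
    then show ?thesis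
      using E.has_bochner_integral_lower_poles[of p q] p pq
      by (simp add: has_bochner_integral_iff mult.assoc)
  next
    case False
    have "(\<integral>t. iexp (t * x) / ((of_real t + \<i> * of_real p) * (of_real t + \<i> * of_real q)) \<partial>lborel) =
       (\<integral>t. exp (\<i> * of_real t * of_real \<bar>x\<bar>) /
         ((of_real t - \<i> * of_real p) * (of_real t - \<i> * of_real q)) \<partial>lborel)"
      using False by (subst lborel_integral_reflect)
        (auto intro!: Bochner_Integration.integral_cong simp: algebra_simps)
    also have "\<dots> = of_real (2 * pi / (q - p)) *
        (of_real (exp (- q * \<bar>x\<bar>)) - of_real (exp (- p * \<bar>x\<bar>)))"
      using E.has_bochner_integral_upper_poles[OF p pq] unfolding exp_imaginary_axis
      by (simp add: has_bochner_integral_iff)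
    finally show ?thesis using False by simp
  qed
qed

lemma (in real_distribution) integral_char_eq:
  fixes k :: "real \<Rightarrow> complex"
  assumes k: "integrable lborel k"
  shows "(\<integral>t. k t * char M t \<partial>lborel) = (\<integral>x. (\<integral>t. k t * iexp (t * x) \<partial>lborel) \<partial>M)"
proof -
  interpret P: pair_sigma_finite M lborel ..
  have [measurable]: "k \<in> borel_measurable borel" using k by auto
  have "integrable (M \<Otimes>\<^sub>M lborel) (\<lambda>(x, t). k t * iexp (t * x))"
  proof (rule P.Fubini_integrable)
    show "AE x in M. integrable lborel (\<lambda>t. case (x, t) of (x, t) \<Rightarrow> k t * iexp (t * x))"
      using integrable_norm[OF k]
      by (auto intro!: Bochner_Integration.integrable_bound[OF k] simp: norm_mult)
  qed (auto simp: norm_mult split_beta')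
  from P.Fubini_integral[OF this] show ?thesis unfolding char_def by simp
qed

lemma (in real_distribution) integral_char_lower_poles:
  assumes p: "0 < p" and pq: "p < q"
  shows "(\<integral>t. char M t / ((of_real t + \<i> * of_real p) * (of_real t + \<i> * of_real q)) \<partial>lborel) =
    of_real (- 2 * pi / (q - p) * (\<integral>x. (if 0 \<le> x then 0 else exp (p * x) - exp (q * x)) \<partial>M))"
proof -
  interpret one: bounded_halfplane_function "\<lambda>_. 1" 1 by standard auto
  let ?k = "\<lambda>t. 1 / ((complex_of_real t + \<i> * of_real p) * (of_real t + \<i> * of_real q))"
  let ?h = "\<lambda>x. if 0 \<le> x then 0 else exp (p * x) - exp (q * x)"
  have "(\<integral>t. ?k t * char M t \<partial>lborel) = (\<integral>x. (\<integral>t. ?k t * iexp (t * x) \<partial>lborel) \<partial>M)"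
    using one.has_bochner_integral_lower_poles[of p q] p pq
    by (intro integral_char_eq) (simp add: has_bochner_integral_iff)
  also have "\<dots> = (\<integral>x. complex_of_real (- 2 * pi / (q - p) * ?h x) \<partial>M)"
    using Fourier_lower_poles_kernel[OF p pq] pq
    by (intro Bochner_Integration.integral_cong) (auto simp: field_simps)
  also have "\<dots> = of_real (- 2 * pi / (q - p) * (\<integral>x. ?h x \<partial>M))"
    by (subst integral_complex_of_real) simp
  finally show ?thesis by simp
qed

text \<open>The Fourier transform of the kernel with both poles in the lower half plane is nonzero
  exactly on the negative half line, where it has constant sign.\<close>
lemma (in real_distribution) AE_nonneg_of_halfplane_char:
  assumes "bounded_halfplane_function F B" and char: "\<And>t. char M t = F (of_real t)"
  shows "AE x in M. 0 \<le> x"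
proof -
  interpret F: bounded_halfplane_function F B by fact
  define h :: "real \<Rightarrow> real" where "h = (\<lambda>x. if 0 \<le> x then 0 else exp (1 * x) - exp (2 * x))"
  have [measurable]: "h \<in> borel_measurable borel" unfolding h_def by measurable
  have h_nonneg: "0 \<le> h x" and h_le: "h x \<le> 1" for x
    by (auto simp: h_def intro: order_trans[of _ "exp x"])
  have h_int: "integrable M h"
    by (rule integrable_const_bound[of _ 1]) (auto simp: h_nonneg h_le)
  have "complex_of_real (- 2 * pi / (2 - 1) * (\<integral>x. h x \<partial>M)) = 0"
    using integral_char_lower_poles[of 1 2] F.has_bochner_integral_lower_poles[of 1 2]
    by (simp add: char h_def has_bochner_integral_iff)
  then have "(\<integral>x. h x \<partial>M) = 0" by simp
  then have "AE x in M. h x = 0"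
    using integral_nonneg_eq_0_iff_AE[OF h_int] h_nonneg by auto
  then show ?thesis
  proof eventually_elim
    fix x assume "h x = 0"
    then show "0 \<le> x" by (cases "0 \<le> x") (auto simp: h_def)
  qed
qed

lemma (in real_distribution) Laplace_of_halfplane_char:
  assumes "bounded_halfplane_function F B" and char: "\<And>t. char M t = F (of_real t)" and v: "v > 0"
  shows "of_real (\<integral>x. exp (- v * x) \<partial>M) = F (\<i> * of_real v)"
proof -
  interpret F: bounded_halfplane_function F B by fact
  interpret one: bounded_halfplane_function "\<lambda>_. 1" 1 by standard auto
  let ?k = "\<lambda>t. 1 / complex_of_real (t\<^sup>2 + v\<^sup>2)"
  have "of_real (pi / v) * F (\<i> * of_real v) = (\<integral>t. ?k t * char M t \<partial>lborel)"
    using F.Poisson_formula[OF v] by (simp add: char)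
  also have "\<dots> = (\<integral>x. (\<integral>t. ?k t * iexp (t * x) \<partial>lborel) \<partial>M)"
    using one.integrable_Cauchy_kernel[OF v] by (intro integral_char_eq)
  also have "\<dots> = (\<integral>x. of_real (pi / v * exp (- v * \<bar>x\<bar>)) \<partial>M)"
    using Fourier_Cauchy_kernel[OF v] by (intro Bochner_Integration.integral_cong) auto
  also have "\<dots> = of_real (pi / v * (\<integral>x. exp (- v * \<bar>x\<bar>) \<partial>M))"
    by (subst integral_complex_of_real) simp
  finally have "F (\<i> * of_real v) = of_real (\<integral>x. exp (- v * \<bar>x\<bar>) \<partial>M)"
    using v by simp
  also have "(\<integral>x. exp (- v * \<bar>x\<bar>) \<partial>M) = (\<integral>x. exp (- v * x) \<partial>M)"
  proof (rule integral_cong_AE)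
    show "AE x in M. exp (- v * \<bar>x\<bar>) = exp (- v * x)"
      using AE_nonneg_of_halfplane_char[OF assms(1,2)] by eventually_elim simp
  qed auto
  finally show ?thesis by simp
qed

lemma (in real_distribution) integrable_exp_nonneg:
  assumes "AE x in M. 0 \<le> x" and "0 \<le> s"
  shows "integrable M (\<lambda>x. exp (- s * x))"
proof (rule integrable_const_bound[of _ 1])
  show "AE x in M. norm (exp (- s * x)) \<le> 1"
    using assms(1) by eventually_elim (use assms(2) in \<open>simp add: mult_nonneg_nonneg\<close>)
qed auto

lemma (in real_distribution) AE_pos_of_Laplace_tendsto_0:
  assumes nonneg: "AE x in M. 0 \<le> x"
    and lim: "((\<lambda>s. \<integral>x. exp (- s * x) \<partial>M) \<longlongrightarrow> 0) at_top"
  shows "AE x in M. 0 < x"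
proof -
  have "prob {0} \<le> (\<integral>x. exp (- s * x) \<partial>M)" if "0 < s" for s
  proof -
    have "prob {0} = (\<integral>x. indicator {0} x \<partial>M)" by simp
    also have "\<dots> \<le> (\<integral>x. exp (- s * x) \<partial>M)"
      using that integrable_exp_nonneg[OF nonneg, of s]
      by (intro integral_mono_AE integrable_real_indicator)
         (auto simp: indicator_def less_top[symmetric])
    finally show ?thesis .
  qed
  then have "prob {0} \<le> 0"
    by (intro tendsto_lowerbound[OF lim] eventually_mono[OF eventually_gt_at_top[of 0]]) auto
  then have "AE x in M. x \<noteq> 0"
    by (intro AE_I[of _ _ "{0}"]) (auto simp: emeasure_eq_measure measure_le_0_iff)
  with nonneg show ?thesis by eventually_elim auto
qed

definition positive_stable_char :: "real \<Rightarrow> real \<Rightarrow> complex" where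
  "positive_stable_char \<alpha> t =
    exp (- (complex_of_real (\<bar>t\<bar> powr \<alpha>)) * exp (- \<i> * complex_of_real (pi * \<alpha> * sgn t / 2)))"

lemma positive_stable_char_eq_exp_powr:
  "positive_stable_char \<alpha> t = exp (- ((- \<i> * of_real t) powr of_real \<alpha>))"
proof (cases "t = 0")
  case False
  have Ln_eq: "Ln (- \<i> * of_real t) = of_real (ln \<bar>t\<bar>) - \<i> * of_real (pi * sgn t / 2)"
  proof (cases "t > 0")
    case True
    have "Ln (of_real t * (- \<i>)) = of_real (ln t) + Ln (- \<i>)"
      using True by (subst Ln_times_of_real) (auto simp: Ln_of_real)
    then show ?thesis using True by (simp add: mult.commute)
  next
    case nonpos: False
    have "Ln (of_real (- t) * \<i>) = of_real (ln (- t)) + Ln \<i>"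
      using nonpos False
      by (subst Ln_times_of_real) (auto simp: Ln_of_real simp flip: of_real_minus)
    then show ?thesis using nonpos False by (simp add: mult.commute)
  qed
  have "(- \<i> * of_real t) powr of_real \<alpha> =
      exp (of_real (\<alpha> * ln \<bar>t\<bar>)) * exp (- \<i> * of_real (pi * \<alpha> * sgn t / 2))"
    using False unfolding exp_add[symmetric] powr_def Ln_eq by (simp add: algebra_simps)
  then show ?thesis
    using False unfolding positive_stable_char_def exp_of_real by (simp add: powr_def)
qed (simp add: positive_stable_char_def)

lemma bounded_halfplane_function_stable:
  assumes \<alpha>: "0 < \<alpha>" "\<alpha> \<le> 1"
  shows "bounded_halfplane_function (\<lambda>z. exp (- ((- \<i> * z) powr of_real \<alpha>))) 1"
proof
  show "continuous_on {z. 0 \<le> Im z} (\<lambda>z. exp (- ((- \<i> * z) powr of_real \<alpha>)))"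
    using \<alpha> by (intro continuous_intros) auto
  show "(\<lambda>z. exp (- ((- \<i> * z) powr of_real \<alpha>))) holomorphic_on {z. 0 < Im z}"
    by (intro holomorphic_intros) (auto simp: complex_nonpos_Reals_iff)
  fix z assume z: "0 \<le> Im z"
  show "norm (exp (- ((- \<i> * z) powr of_real \<alpha>))) \<le> 1"
  proof (cases "z = 0")
    case False
    define w where "w = - \<i> * z"
    have w: "w \<noteq> 0" "0 \<le> Re w" using False z by (auto simp: w_def)
    then have "\<bar>Im (Ln w)\<bar> \<le> pi / 2" using Re_Ln_pos_le by blast
    then have "\<bar>\<alpha> * Im (Ln w)\<bar> \<le> 1 * (pi / 2)"
      using \<alpha> unfolding abs_mult by (intro mult_mono) auto
    then have "cos (\<alpha> * Im (Ln w)) \<ge> 0" by (intro cos_ge_zero) auto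
    then have "Re (w powr of_real \<alpha>) \<ge> 0" using w by (simp add: powr_def Re_exp)
    then show ?thesis by (simp add: w_def)
  qed simp
qed

locale positive_stable_distribution = real_distribution +
  fixes \<alpha> :: real
  assumes index: "0 < \<alpha>" "\<alpha> \<le> 1" and char_eq: "char M = positive_stable_char \<alpha>"
begin

lemma AE_nonneg: "AE x in M. 0 \<le> x"
  using AE_nonneg_of_halfplane_char[OF bounded_halfplane_function_stable[OF index]]
  by (simp add: char_eq positive_stable_char_eq_exp_powr)

lemma Laplace:
  assumes "0 \<le> s"
  shows "(\<integral>x. exp (- s * x) \<partial>M) = exp (- (s powr \<alpha>))"
proof (cases "s = 0")
  case False
  then have s: "0 < s" using assms by simp
  have "complex_of_real (\<integral>x. exp (- s * x) \<partial>M) = exp (- ((- \<i> * (\<i> * of_real s)) powr of_real \<alpha>))"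
    using bounded_halfplane_function_stable[OF index] s
    by (intro Laplace_of_halfplane_char) (simp_all add: char_eq positive_stable_char_eq_exp_powr)
  also have "(- \<i> * (\<i> * of_real s)) powr of_real \<alpha> = complex_of_real (s powr \<alpha>)"
    using s by (simp add: powr_of_real)
  finally show ?thesis by (metis exp_of_real of_real_eq_iff of_real_minus)
qed (simp add: prob_space[simplified])

lemma nn_integral_Laplace:
  "0 \<le> s \<Longrightarrow> (\<integral>\<^sup>+x. ennreal (exp (- s * x)) \<partial>M) = ennreal (exp (- (s powr \<alpha>)))"
  using integrable_exp_nonneg[OF AE_nonneg, of s] Laplace[of s]
  by (simp add: nn_integral_eq_integral)

lemma AE_pos: "AE x in M. 0 < x"
proof (rule AE_pos_of_Laplace_tendsto_0[OF AE_nonneg])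
  have "((\<lambda>s. exp (- (s powr \<alpha>))) \<longlongrightarrow> 0) at_top" using index by real_asymp
  then show "((\<lambda>s. \<integral>x. exp (- s * x) \<partial>M) \<longlongrightarrow> 0) at_top"
    by (rule Lim_transform_eventually)
       (auto intro!: eventually_mono[OF eventually_ge_at_top[of 0]] simp: Laplace[symmetric])
qed

end

section \<open>The mixed exponential representation\<close>

lemma gamma_density_Laplace:
  assumes s: "0 < s" and a: "0 \<le> a"
  shows "(\<integral>\<^sup>+x. ennreal (gamma_density s x) * ennreal (exp (- a * x)) \<partial>lborel) =
    ennreal ((1 + a) powr - s)"
proof -
  have "gamma_density s x * exp (- a * x) = (1 + a) powr - s * gg_density s 1 (1 + a) x" for x
    using a by (simp add: gamma_density_def gg_density_def powr_minus field_simps flip: exp_add)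
  then have "ennreal (gamma_density s x) * ennreal (exp (- a * x)) =
      ennreal ((1 + a) powr - s) * ennreal (gg_density s 1 (1 + a) x)" for x
    using s
    by (simp only: ennreal_mult[symmetric] gamma_density_nonneg
        gg_density_nonneg exp_ge_zero powr_ge_zero)
  then have "(\<integral>\<^sup>+x. ennreal (gamma_density s x) * ennreal (exp (- a * x)) \<partial>lborel) =
      ennreal ((1 + a) powr - s) * (\<integral>\<^sup>+x. ennreal (gg_density s 1 (1 + a) x) \<partial>lborel)"
    by (simp add: nn_integral_cmult)
  then show ?thesis using s a by (simp add: nn_integral_gg_density)
qed

lemma emeasure_gamma_distribution_greaterThan:
  assumes r: "0 < r" and y: "0 \<le> y"
  shows "emeasure (gamma_distribution r) {y<..} =
    (\<integral>\<^sup>+g. ennreal (exp (- y) * (1 + y / g) powr (r - 1)) \<partial>gamma_distribution r)"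
proof -
  have "emeasure (gamma_distribution r) {y<..} =
      (\<integral>\<^sup>+u. ennreal (gamma_density r u) * indicator {y<..} u \<partial>lborel)"
    by (simp add: emeasure_density)
  also have "\<dots> = (\<integral>\<^sup>+g. ennreal (gamma_density r (y + g)) * indicator {y<..} (y + g) \<partial>lborel)"
    using nn_integral_real_affine[of "\<lambda>u. ennreal (gamma_density r u) * indicator {y<..} u" 1 y]
    by simp
  also have "\<dots> =
      (\<integral>\<^sup>+g. ennreal (gamma_density r g) * ennreal (exp (- y) * (1 + y / g) powr (r - 1)) \<partial>lborel)"
  proof (rule nn_integral_cong)
    fix g
    show "ennreal (gamma_density r (y + g)) * indicator {y<..} (y + g) =
      ennreal (gamma_density r g) * ennreal (exp (- y) * (1 + y / g) powr (r - 1))"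
    proof (cases "g > 0")
      case True
      then have "1 + y / g = (y + g) / g" by (simp add: field_simps)
      then have "g powr (r - 1) * (1 + y / g) powr (r - 1) = (y + g) powr (r - 1)"
        using True y by (simp add: powr_divide)
      then have "gamma_density r (y + g) =
          gamma_density r g * (exp (- y) * (1 + y / g) powr (r - 1))"
        using True y by (simp add: gamma_density_def exp_add exp_diff exp_minus field_simps)
      then show ?thesis using True r by (simp add: ennreal_mult')
    qed (auto simp: gamma_density_def)
  qed
  also have "\<dots> = (\<integral>\<^sup>+g. ennreal (exp (- y) * (1 + y / g) powr (r - 1)) \<partial>gamma_distribution r)"
    by (subst nn_integral_density) auto
  finally show ?thesis .
qed

lemma (in prob_space) nn_integral_indep_var:
  assumes indep: "indep_var S X T Y"
    and h [measurable]: "(\<lambda>(x, y). h x y) \<in> borel_measurable (S \<Otimes>\<^sub>M T)"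
  shows "(\<integral>\<^sup>+\<omega>. h (X \<omega>) (Y \<omega>) \<partial>M) = (\<integral>\<^sup>+\<omega>'. \<integral>\<^sup>+\<omega>. h (X \<omega>) (Y \<omega>') \<partial>M \<partial>M)"
proof -
  have X [measurable]: "X \<in> measurable M S" and Y [measurable]: "Y \<in> measurable M T"
    and joint: "distr M S X \<Otimes>\<^sub>M distr M T Y = distr M (S \<Otimes>\<^sub>M T) (\<lambda>\<omega>. (X \<omega>, Y \<omega>))"
    using indep by (auto simp: indep_var_distribution_eq)
  interpret PX: prob_space "distr M S X" by (rule prob_space_distr) simp
  interpret PY: prob_space "distr M T Y" by (rule prob_space_distr) simp
  interpret P: pair_sigma_finite "distr M S X" "distr M T Y" ..
  have "(\<integral>\<^sup>+\<omega>. h (X \<omega>) (Y \<omega>) \<partial>M) =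
      (\<integral>\<^sup>+z. (case z of (x, y) \<Rightarrow> h x y) \<partial>(distr M S X \<Otimes>\<^sub>M distr M T Y))"
    unfolding joint by (subst nn_integral_distr) auto
  also have "\<dots> = (\<integral>\<^sup>+y. \<integral>\<^sup>+x. h x y \<partial>distr M S X \<partial>distr M T Y)"
    by (subst P.nn_integral_snd[symmetric]) auto
  also have "\<dots> = (\<integral>\<^sup>+\<omega>'. \<integral>\<^sup>+x. h x (Y \<omega>') \<partial>distr M S X \<partial>M)"
    by (subst nn_integral_distr) auto
  also have "\<dots> = (\<integral>\<^sup>+\<omega>'. \<integral>\<^sup>+\<omega>. h (X \<omega>) (Y \<omega>') \<partial>M \<partial>M)"
    by (intro nn_integral_cong) (subst nn_integral_distr, auto)
  finally show ?thesis .
qed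

lemma (in prob_space) emeasure_mixed_exponential_greaterThan:
  assumes W: "distributed M lborel W (\<lambda>x. ennreal (exponential_density 1 x))"
    and indep: "indep_var borel W borel V" and V_pos: "AE \<omega> in M. 0 < V \<omega>" and x: "0 \<le> x"
  shows "emeasure M {\<omega> \<in> space M. x < W \<omega> / V \<omega>} = (\<integral>\<^sup>+\<omega>. ennreal (exp (- (x * V \<omega>))) \<partial>M)"
proof -
  have [measurable]: "W \<in> borel_measurable M" "V \<in> borel_measurable M"
    using indep_var_rv1[OF indep] indep_var_rv2[OF indep] by auto
  have "emeasure M {\<omega> \<in> space M. x < W \<omega> / V \<omega>} =
      (\<integral>\<^sup>+\<omega>. indicator {\<omega> \<in> space M. x < W \<omega> / V \<omega>} \<omega> \<partial>M)"
    by (rule nn_integral_indicator[symmetric]) measurable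
  also have "\<dots> = (\<integral>\<^sup>+\<omega>. indicator {(w, v). x < w / v} (W \<omega>, V \<omega>) \<partial>M)"
    by (intro nn_integral_cong) (simp add: indicator_def)
  also have "\<dots> = (\<integral>\<^sup>+\<omega>'. \<integral>\<^sup>+\<omega>. indicator {(w, v). x < w / v} (W \<omega>, V \<omega>') \<partial>M \<partial>M)"
    by (rule nn_integral_indep_var[OF indep]) measurable
  also have "\<dots> = (\<integral>\<^sup>+\<omega>'. ennreal (exp (- (x * V \<omega>'))) \<partial>M)"
  proof (rule nn_integral_cong_AE)
    show "AE \<omega>' in M. (\<integral>\<^sup>+\<omega>. indicator {(w, v). x < w / v} (W \<omega>, V \<omega>') \<partial>M) =
        ennreal (exp (- (x * V \<omega>')))"
      using V_pos
    proof eventually_elim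
      fix \<omega>' assume V: "0 < V \<omega>'"
      then have "(\<integral>\<^sup>+\<omega>. indicator {(w, v). x < w / v} (W \<omega>, V \<omega>') \<partial>M) =
          (\<integral>\<^sup>+\<omega>. indicator {\<omega> \<in> space M. x * V \<omega>' < W \<omega>} \<omega> \<partial>M)"
        by (intro nn_integral_cong) (simp add: indicator_def field_simps)
      also have "\<dots> = emeasure M {\<omega> \<in> space M. x * V \<omega>' < W \<omega>}"
        by (rule nn_integral_indicator) measurable
      also have "\<dots> = ennreal (exp (- (x * V \<omega>')))"
        using exponential_distributedD_gt[OF W, of "x * V \<omega>'"] x V
        by (simp add: emeasure_eq_measure)
      finally show "(\<integral>\<^sup>+\<omega>. indicator {(w, v). x < w / v} (W \<omega>, V \<omega>') \<partial>M) =
          ennreal (exp (- (x * V \<omega>')))" .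
    qed
  qed
  finally show ?thesis .
qed

lemma (in prob_space) nn_integral_exp_stable_mult:
  assumes S: "positive_stable_distribution (distr M borel S) \<alpha>"
    and indep: "indep_var borel S borel T" and T_nonneg: "\<And>\<omega>. \<omega> \<in> space M \<Longrightarrow> 0 \<le> T \<omega>"
  shows "(\<integral>\<^sup>+\<omega>. ennreal (exp (- (T \<omega> * S \<omega>))) \<partial>M) = (\<integral>\<^sup>+\<omega>. ennreal (exp (- (T \<omega> powr \<alpha>))) \<partial>M)"
proof -
  interpret S: positive_stable_distribution "distr M borel S" \<alpha> by fact
  have [measurable]: "S \<in> borel_measurable M" using indep_var_rv1[OF indep] by simp
  have "(\<integral>\<^sup>+\<omega>. ennreal (exp (- (T \<omega> * S \<omega>))) \<partial>M) =
      (\<integral>\<^sup>+\<omega>'. \<integral>\<^sup>+\<omega>. ennreal (exp (- (T \<omega>' * S \<omega>))) \<partial>M \<partial>M)"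
    by (rule nn_integral_indep_var[OF indep]) measurable
  also have "\<dots> = (\<integral>\<^sup>+\<omega>'. ennreal (exp (- (T \<omega>' powr \<alpha>))) \<partial>M)"
  proof (rule nn_integral_cong)
    fix \<omega>' assume "\<omega>' \<in> space M"
    then show "(\<integral>\<^sup>+\<omega>. ennreal (exp (- (T \<omega>' * S \<omega>))) \<partial>M) = ennreal (exp (- (T \<omega>' powr \<alpha>)))"
      using S.nn_integral_Laplace[OF T_nonneg] by (simp add: nn_integral_distr)
  qed
  finally show ?thesis .
qed

lemma AE_gamma_distributed_pos:
  assumes "distributed M lborel G (\<lambda>x. ennreal (gamma_density s x))"
  shows "AE \<omega> in M. 0 < G \<omega>"
proof -
  have law: "distr M lborel G = gamma_distribution s"
    using assms by (simp add: distributed_def)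
  have "AE g in distr M lborel G. 0 < g"
    unfolding law by (rule AE_gamma_distribution_pos)
  then show ?thesis
    using distributed_measurable[OF assms] by (subst (asm) AE_distr_iff) auto
qed

lemma (in prob_space) nn_integral_exp_gamma_ratio:
  assumes G1: "distributed M lborel G1 (\<lambda>x. ennreal (gamma_density r x))"
    and G2: "distributed M lborel G2 (\<lambda>x. ennreal (gamma_density (1 - r) x))"
    and indep: "indep_var borel G2 borel G1"
    and r: "0 < r" "r < 1" and y: "0 \<le> y"
  shows "(\<integral>\<^sup>+\<omega>. ennreal (exp (- (y * ((G1 \<omega> + G2 \<omega>) / G1 \<omega>)))) \<partial>M) =
    emeasure (gamma_distribution r) {y<..}"
proof -
  have [measurable]: "G1 \<in> borel_measurable M" "G2 \<in> borel_measurable M"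
    using G1 G2 by (auto simp: distributed_def)
  have G1_law: "distr M borel G1 = gamma_distribution r"
    and G2_law: "distr M borel G2 = gamma_distribution (1 - r)"
    using G1 G2 by (simp_all add: distributed_def cong: distr_cong)
  have inner: "(\<integral>\<^sup>+\<omega>. ennreal (exp (- (y * ((g + G2 \<omega>) / g)))) \<partial>M) =
      ennreal (exp (- y) * (1 + y / g) powr (r - 1))" if g: "0 < g" for g
  proof -
    have "exp (- (y * ((g + g') / g))) = exp (- y) * exp (- (y / g) * g')" for g'
      using g by (simp add: field_simps flip: exp_add)
    then have "(\<integral>\<^sup>+\<omega>. ennreal (exp (- (y * ((g + G2 \<omega>) / g)))) \<partial>M) =
        ennreal (exp (- y)) * (\<integral>\<^sup>+\<omega>. ennreal (exp (- (y / g) * G2 \<omega>)) \<partial>M)"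
      by (simp add: nn_integral_cmult ennreal_mult)
    also have "(\<integral>\<^sup>+\<omega>. ennreal (exp (- (y / g) * G2 \<omega>)) \<partial>M) =
        (\<integral>\<^sup>+g'. ennreal (exp (- (y / g) * g')) \<partial>distr M borel G2)"
      by (subst nn_integral_distr) auto
    also have "\<dots> = ennreal ((1 + y / g) powr (r - 1))"
      unfolding G2_law using gamma_density_Laplace[of "1 - r" "y / g"] r y g
      by (subst nn_integral_density) auto
    finally show ?thesis by (simp add: ennreal_mult)
  qed
  have "(\<integral>\<^sup>+\<omega>. ennreal (exp (- (y * ((G1 \<omega> + G2 \<omega>) / G1 \<omega>)))) \<partial>M) =
      (\<integral>\<^sup>+\<omega>'. \<integral>\<^sup>+\<omega>. ennreal (exp (- (y * ((G1 \<omega>' + G2 \<omega>) / G1 \<omega>')))) \<partial>M \<partial>M)"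
    by (rule nn_integral_indep_var[OF indep]) measurable
  also have "\<dots> = (\<integral>\<^sup>+\<omega>'. ennreal (exp (- y) * (1 + y / G1 \<omega>') powr (r - 1)) \<partial>M)"
  proof (rule nn_integral_cong_AE)
    show "AE \<omega>' in M. (\<integral>\<^sup>+\<omega>. ennreal (exp (- (y * ((G1 \<omega>' + G2 \<omega>) / G1 \<omega>')))) \<partial>M) =
        ennreal (exp (- y) * (1 + y / G1 \<omega>') powr (r - 1))"
      using AE_gamma_distributed_pos[OF G1] by eventually_elim (rule inner)
  qed
  also have "\<dots> = (\<integral>\<^sup>+g. ennreal (exp (- y) * (1 + y / g) powr (r - 1)) \<partial>distr M borel G1)"
    by (subst nn_integral_distr) auto
  also have "\<dots> = emeasure (gamma_distribution r) {y<..}"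
    unfolding G1_law using r y by (intro emeasure_gamma_distribution_greaterThan[symmetric]) auto
  finally show ?thesis .
qed

lemma real_distribution_eqI_greaterThan:
  assumes P: "real_distribution P" and Q: "real_distribution Q" and Q_pos: "AE x in Q. 0 < x"
    and tail: "\<And>x. 0 \<le> x \<Longrightarrow> emeasure P {x<..} = emeasure Q {x<..}"
  shows "P = Q"
proof (rule cdf_unique[OF P Q], rule ext)
  interpret P: real_distribution P by fact
  interpret Q: real_distribution Q by fact
  have compl: "UNIV - {x<..} = {..x}" for x :: real by auto
  have nonneg: "cdf P x = cdf Q x" if "0 \<le> x" for x
    using P.prob_compl[of "{x<..}"] Q.prob_compl[of "{x<..}"] tail[OF that]
    by (simp add: cdf_def compl measure_def)
  have "cdf Q 0 = 0"
    unfolding cdf_def using Q_pos by (subst Q.prob_eq_0) (auto elim!: eventually_mono)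
  fix x
  show "cdf P x = cdf Q x"
  proof (cases "0 \<le> x")
    case False
    then have "cdf P x \<le> 0" "cdf Q x \<le> 0"
      using P.cdf_nondecreasing[of x 0] Q.cdf_nondecreasing[of x 0] nonneg[of 0] \<open>cdf Q 0 = 0\<close>
      by auto
    then show ?thesis using P.cdf_nonneg[of x] Q.cdf_nonneg[of x] by linarith
  qed (rule nonneg)
qed

lemma (in prob_space) emeasure_exponential_stable_ratio_greaterThan:
  assumes \<alpha>: "0 < \<alpha>" and x: "0 \<le> x"
    and W: "distributed M lborel W (\<lambda>x. ennreal (exponential_density 1 x))"
    and S: "positive_stable_distribution (distr M borel S) \<alpha>"
    and Z_pos: "AE \<omega> in M. 0 < Z \<omega>"
    and indep_W: "indep_var borel W borel (\<lambda>\<omega>. S \<omega> * Z \<omega> powr (1 / \<alpha>))"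
    and indep_S: "indep_var borel S borel Z"
  shows "emeasure M {\<omega> \<in> space M. x < W \<omega> / (S \<omega> * Z \<omega> powr (1 / \<alpha>))} =
    (\<integral>\<^sup>+\<omega>. ennreal (exp (- (x powr \<alpha> * Z \<omega>))) \<partial>M)"
proof -
  interpret S: positive_stable_distribution "distr M borel S" \<alpha> by fact
  have [measurable]: "S \<in> borel_measurable M" using indep_var_rv1[OF indep_S] by simp
  have "AE \<omega> in M. 0 < S \<omega>" using S.AE_pos by (subst (asm) AE_distr_iff) auto
  then have V_pos: "AE \<omega> in M. 0 < S \<omega> * Z \<omega> powr (1 / \<alpha>)"
    using Z_pos by eventually_elim simp
  define T where "T = (\<lambda>\<omega>. x * Z \<omega> powr (1 / \<alpha>))"
  have T_powr: "AE \<omega> in M. T \<omega> powr \<alpha> = x powr \<alpha> * Z \<omega>"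
    using Z_pos by eventually_elim (use \<alpha> x in \<open>simp add: T_def powr_mult powr_powr\<close>)
  have indep_T: "indep_var borel S borel T"
    using indep_var_compose[OF indep_S, of "\<lambda>s. s" borel "\<lambda>z. x * z powr (1 / \<alpha>)" borel]
    by (simp add: T_def comp_def)
  have "emeasure M {\<omega> \<in> space M. x < W \<omega> / (S \<omega> * Z \<omega> powr (1 / \<alpha>))} =
      (\<integral>\<^sup>+\<omega>. ennreal (exp (- (T \<omega> * S \<omega>))) \<partial>M)"
    using emeasure_mixed_exponential_greaterThan[OF W indep_W V_pos x] by (simp add: T_def mult_ac)
  also have "\<dots> = (\<integral>\<^sup>+\<omega>. ennreal (exp (- (T \<omega> powr \<alpha>))) \<partial>M)"
    using x by (intro nn_integral_exp_stable_mult[OF S indep_T]) (simp add: T_def)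
  also have "\<dots> = (\<integral>\<^sup>+\<omega>. ennreal (exp (- (x powr \<alpha> * Z \<omega>))) \<partial>M)"
    using T_powr by (intro nn_integral_cong_AE) (auto elim!: eventually_mono)
  finally show ?thesis .
qed

theorem (in prob_space) distr_mixed_exponential_eq_gg_distribution:
  assumes r: "0 < r" "r < 1" and \<alpha>: "0 < \<alpha>" "\<alpha> \<le> 1" and c: "0 < c"
    and W: "distributed M lborel W (\<lambda>x. ennreal (exponential_density 1 x))"
    and S: "char (distr M borel S) = positive_stable_char \<alpha>"
    and G1: "distributed M lborel G1 (\<lambda>x. ennreal (gamma_density r x))"
    and G2: "distributed M lborel G2 (\<lambda>x. ennreal (gamma_density (1 - r) x))"
    and indep_W: "indep_var borel W borel (\<lambda>\<omega>. S \<omega> * ((G1 \<omega> + G2 \<omega>) / G1 \<omega>) powr (1 / \<alpha>))"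
    and indep_S: "indep_var borel S borel (\<lambda>\<omega>. (G1 \<omega> + G2 \<omega>) / G1 \<omega>)"
    and indep_G: "indep_var borel G2 borel G1"
  shows "distr M borel (\<lambda>\<omega>. c * W \<omega> / (S \<omega> * ((G1 \<omega> + G2 \<omega>) / G1 \<omega>) powr (1 / \<alpha>))) =
    gg_distribution r \<alpha> (c powr - \<alpha>)" (is "distr M borel ?Y = _")
proof (rule real_distribution_eqI_greaterThan)
  have [measurable]: "W \<in> borel_measurable M" "S \<in> borel_measurable M"
    "G1 \<in> borel_measurable M" "G2 \<in> borel_measurable M"
    using indep_var_rv1[OF indep_W] indep_var_rv1[OF indep_S]
      indep_var_rv1[OF indep_G] indep_var_rv2[OF indep_G] by auto
  show "real_distribution (distr M borel ?Y)" by (rule real_distribution_distr) measurable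
  have stable: "positive_stable_distribution (distr M borel S) \<alpha>"
    using \<alpha> S real_distribution_distr[of S]
    by (simp add: positive_stable_distribution_def positive_stable_distribution_axioms_def)
  have Z_pos: "AE \<omega> in M. 0 < (G1 \<omega> + G2 \<omega>) / G1 \<omega>"
    using AE_gamma_distributed_pos[OF G1] AE_gamma_distributed_pos[OF G2] by eventually_elim simp
  fix x :: real assume x: "0 \<le> x"
  have "?Y -` {x<..} \<inter> space M =
      {\<omega> \<in> space M. x / c < W \<omega> / (S \<omega> * ((G1 \<omega> + G2 \<omega>) / G1 \<omega>) powr (1 / \<alpha>))}"
    using c by (auto simp: pos_divide_less_eq mult.commute)
  then have "emeasure (distr M borel ?Y) {x<..} =
      (\<integral>\<^sup>+\<omega>. ennreal (exp (- ((x / c) powr \<alpha> * ((G1 \<omega> + G2 \<omega>) / G1 \<omega>)))) \<partial>M)"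
    using emeasure_exponential_stable_ratio_greaterThan
        [OF \<alpha>(1) _ W stable Z_pos indep_W indep_S, of "x / c"] x c
    by (simp add: emeasure_distr)
  also have "\<dots> = emeasure (gamma_distribution r) {(x / c) powr \<alpha><..}"
    using r by (intro nn_integral_exp_gamma_ratio G1 G2 indep_G) simp_all
  also have "(x / c) powr \<alpha> = c powr - \<alpha> * x powr \<alpha>"
    using x c by (simp add: powr_divide powr_minus_divide)
  also have "emeasure (gamma_distribution r) {c powr - \<alpha> * x powr \<alpha><..} =
      emeasure (gg_distribution r \<alpha> (c powr - \<alpha>)) {x<..}"
    using r \<alpha> c x by (intro emeasure_gg_distribution_greaterThan[symmetric]) auto
  finally show "emeasure (distr M borel ?Y) {x<..} =
      emeasure (gg_distribution r \<alpha> (c powr - \<alpha>)) {x<..}" .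
qed (use r \<alpha> c in \<open>auto intro!: real_distribution_gg AE_gg_distribution_pos\<close>)

lemma (in prob_space) indep_var_of_indep_vars:
  assumes "indep_vars M' X I" "A \<inter> B = {}" "A \<subseteq> I" "B \<subseteq> I"
    and "f \<in> measurable (Pi\<^sub>M A M') S" "g \<in> measurable (Pi\<^sub>M B M') T"
  shows "indep_var S (\<lambda>\<omega>. f (\<lambda>i\<in>A. X i \<omega>)) T (\<lambda>\<omega>. g (\<lambda>i\<in>B. X i \<omega>))"
  using indep_var_compose[OF indep_var_restrict[OF assms(1-4)] assms(5,6)] by (simp add: comp_def)

lemma (in prob_space) indep_var_mixed_exponential_factors:
  fixes W S G1 G2 :: "'a \<Rightarrow> real"
  assumes "indep_vars (\<lambda>_. borel)
      (\<lambda>i::nat. if i = 0 then W else if i = 1 then S else if i = 2 then G1 else G2) {0, 1, 2, 3}"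
  shows "indep_var borel W borel (\<lambda>\<omega>. S \<omega> * ((G1 \<omega> + G2 \<omega>) / G1 \<omega>) powr a)"
    and "indep_var borel S borel (\<lambda>\<omega>. (G1 \<omega> + G2 \<omega>) / G1 \<omega>)"
    and "indep_var borel G2 borel G1"
proof -
  note grouped = indep_var_of_indep_vars[OF assms, where S = borel and T = borel]
  show "indep_var borel W borel (\<lambda>\<omega>. S \<omega> * ((G1 \<omega> + G2 \<omega>) / G1 \<omega>) powr a)"
    using grouped[of "{0}" "{1, 2, 3}" "\<lambda>h. h 0" "\<lambda>h. h 1 * ((h 2 + h 3) / h 2) powr a"] by simp
  show "indep_var borel S borel (\<lambda>\<omega>. (G1 \<omega> + G2 \<omega>) / G1 \<omega>)"
    using grouped[of "{1}" "{2, 3}" "\<lambda>h. h 1" "\<lambda>h. (h 2 + h 3) / h 2"] by simp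
  show "indep_var borel G2 borel G1"
    using grouped[of "{3}" "{2}" "\<lambda>h. h 3" "\<lambda>h. h 2"] by simp
qed

theorem theorem5:
  fixes M :: "'a measure"
    and X :: "nat \<Rightarrow> 'a \<Rightarrow> real"
    and N :: "nat \<Rightarrow> 'a \<Rightarrow> nat"
    and c r \<alpha> :: real
  assumes "prob_space M"
    and iid_indep: "prob_space.indep_vars M (\<lambda>_. borel) X UNIV"
    and iid_distr: "\<And>i. distr M borel (X i) = distr M borel (X 0)"
    and nonneg: "\<And>j \<omega>. \<omega> \<in> space M \<Longrightarrow> X j \<omega> \<ge> 0"
    and c_pos: "0 < c"
    and slln: "AE \<omega> in M. (\<lambda>n. (\<Sum>j<n. X j \<omega>) / real n) \<longlonglongrightarrow> c"
    and r_pos: "0 < r"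
    and \<alpha>_nz: "\<alpha> \<noteq> 0"
    and N_rv: "\<And>n. N n \<in> measurable M (count_space UNIV)"
    and N_distr: "\<And>n k. n \<ge> 1 \<Longrightarrow>
        measure M {\<omega> \<in> space M. N n \<omega> = k} = gnb_pmf r \<alpha> (real n powr (- \<alpha>)) k"
    and N_indep: "\<And>n. n \<ge> 1 \<Longrightarrow>
        prob_space.indep_set M
          (sigma_sets (space M) {N n -` A \<inter> space M | A. A \<in> sets (count_space UNIV)})
          (sigma_sets (space M) (\<Union>i. {X i -` A \<inter> space M | A. A \<in> sets borel}))"
  shows "((\<lambda>n. SUP x\<in>{0..}. \<bar>measure M {\<omega> \<in> space M. (\<Sum>j<N n \<omega>. X j \<omega>) < real n * x}
              - (LBINT z=0..x. gg_density r \<alpha> (c powr (- \<alpha>)) z)\<bar>) \<longlonglongrightarrow> 0)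
    \<and> (r < 1 \<and> 0 < \<alpha> \<and> \<alpha> < 1 \<longrightarrow>
      (\<forall>M' :: 'b measure. \<forall>W S G1 G2.
        prob_space M'
        \<and> prob_space.indep_vars M' (\<lambda>_. borel)
            (\<lambda>i::nat. if i = 0 then W else if i = 1 then S else if i = 2 then G1 else G2) {0, 1, 2, 3}
        \<and> distributed M' lborel W (\<lambda>x. ennreal (exponential_density 1 x))
        \<and> S \<in> borel_measurable M'
        \<and> (\<forall>t. char (distr M' borel S) t
               = exp (- (complex_of_real (\<bar>t\<bar> powr \<alpha>))
                      * exp (- \<i> * complex_of_real (pi * \<alpha> * sgn t / 2))))
        \<and> distributed M' lborel G1 (\<lambda>x. ennreal (gamma_density r x))
        \<and> distributed M' lborel G2 (\<lambda>x. ennreal (gamma_density (1 - r) x))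
        \<longrightarrow> distr M' lborel
              (\<lambda>\<omega>. c * W \<omega> / (S \<omega> * ((G1 \<omega> + G2 \<omega>) / G1 \<omega>) powr (1 / \<alpha>)))
            = density lborel (\<lambda>x. ennreal (gg_density r \<alpha> (c powr (- \<alpha>)) x))))"
proof (intro conjI impI allI, goal_cases uniform_convergence mixed_exponential)
  case uniform_convergence
  interpret prob_space M by fact
  have "X i \<in> borel_measurable M" for i
    using iid_indep by (simp add: indep_vars_def)
  then interpret gnb_random_sum M X N c r \<alpha>
    using nonneg c_pos slln r_pos \<alpha>_nz N_rv N_distr by unfold_locales
  show ?case by (rule SUP_random_sum_cdf_diff_tendsto_0)
next
  case (mixed_exponential M' W S G1 G2)
  then interpret M': prob_space M' by blast
  have "char (distr M' borel S) = positive_stable_char \<alpha>"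
    using mixed_exponential by (auto simp: positive_stable_char_def)
  moreover have "M'.indep_vars (\<lambda>_. borel)
      (\<lambda>i::nat. if i = 0 then W else if i = 1 then S else if i = 2 then G1 else G2) {0, 1, 2, 3}"
    using mixed_exponential by blast
  ultimately have "distr M' borel (\<lambda>\<omega>. c * W \<omega> / (S \<omega> * ((G1 \<omega> + G2 \<omega>) / G1 \<omega>) powr (1 / \<alpha>))) =
      gg_distribution r \<alpha> (c powr - \<alpha>)"
    using mixed_exponential r_pos c_pos
    by (intro M'.distr_mixed_exponential_eq_gg_distribution
        M'.indep_var_mixed_exponential_factors) auto
  then show ?case by (simp cong: distr_cong)
qed

end
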